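(* Let $(\mathbb{C},p:\dot{\mathcal{U}}\to\mathcal{U})$ be a natural model admitting a unit type and let $\mathbb{U}=\mathbb{S}(p)$ be its associated full internal subcategory of $\widehat{\mathbb{C}}$. Then $(\mathbb{C},p)$ admits dependent sum types if and only if the internal functor $\widetilde{\Delta}:\mathbb{U}\to\mathrm{Fam}_{\mathbb{U}}(\mathbb{U})$ has an internal right adjoint.
   Context: Write $\widehat{\mathbb{C}}=\mathbf{Set}^{\mathbb{C}^{\mathrm{op}}}$ and $\mathsf{y}$ for the Yoneda embedding; elements $x\in P(\Gamma)$ are identified with maps $\mathsf{y}(\Gamma)\to P$. A natural model $(\mathbb{C},p)$ consists of a small category $\mathbb{C}$ with a distinguished terminal object $\diamond$, presheaves $\mathcal{U},\dot{\mathcal{U}}$, a natural transformation $p:\dot{\mathcal{U}}\to\mathcal{U}$ and, for each $\Gamma$ and $A\in\mathcal{U}(\Gamma)$, a chosen object $\Gamma\cdot A$, morphism $\mathsf{p}_A:\Gamma\cdot A\to\Gamma$ and element $\mathsf{q}_A\in\dot{\mathcal{U}}(\Gamma\cdot A)$ such that the square with top $\mathsf{q}_A$, right $p$, left $\mathsf{y}(\mathsf{p}_A)$, bottom $A$ is a pullback. In the internal language of $\widehat{\mathbb{C}}$, $[A]$ denotes the fibre of $p$ over $A\in\mathcal{U}$. $(\mathbb{C},p)$ **admits a unit type** if there are $\widehat{\mathbb{1}}:1\to\mathcal{U}$, $\widehat\star:1\to\dot{\mathcal{U}}$ exhibiting $\mathrm{id}_1$ as a pullback of $p$; **admits dependent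 sum types** if there are $\widehat\Sigma:\sum_{A:\mathcal{U}}\mathcal{U}^{[A]}\to\mathcal{U}$ and $\widehat{\mathsf{pair}}:\sum_{A:\mathcal{U}}\sum_{B:\mathcal{U}^{[A]}}\sum_{a:[A]}[B(a)]\to\dot{\mathcal{U}}$ exhibiting the projection $(A,B,a,b)\mapsto(A,B)$ as a pullback of $p$. For $f:B\to A$ in a locally cartesian closed category $\mathcal{E}$, $\mathbb{S}(f)$ is the internal category of $\mathcal{E}$ with object of objects $A$, object of morphisms $\sum_{a,a'\in A}B_{a'}^{B_a}$, and identities and composition given internally. So $\mathbb{U}_0=\mathcal{U}$, $\mathbb{U}_1=\sum_{A,B\in\mathcal{U}}[B]^{[A]}$. For $\mathbb{A}=\mathbb{S}(B\to A)$ and $\mathbb{I}=\mathbb{S}(J\to I)$, $\mathrm{Fam}_{\mathbb{I}}(\mathbb{A})$ is the internal category with object of objects $\sum_{i\in I}A^{J_i}$; object of morphisms $\sum_{(i,a),(i',a')}\sum_{\alpha\in J_{i'}^{J_i}}\prod_{j\in J_i}B_{a'(\alpha(j))}^{B_{a(j)}}$ (so a morphism $(i,a)\to(i',a')$ is a map $\alpha:J_i\to J_{i'}$ with maps $b_j:B_{a(j)}\to B_{a'(\alpha(j))}$ for $j\in J_i$); identities $(\lambda j.j,\lambda j.\mathrm{id})$; and composition $(\beta,b')\circ(\alpha,b)=(\beta\circ\alpha,\lambda j.\,b'_{\alpha(j)}\circ b_j)$. The unit type gives an internal terminal object $\mathbf{1}=\widehat{\mathbb{1}}$ of $\mathbb{U}$.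 The internal functor $\widetilde\Delta:\mathbb{U}\to\mathrm{Fam}_{\mathbb{U}}(\mathbb{U})$ is given on objects by $A\mapsto(A,\underline{\mathbf{1}})$, where $\underline{\mathbf{1}}\in\mathcal{U}^{[A]}$ is constant at $\mathbf{1}$, and on morphisms $f:[A]\to[A']$ by $f\mapsto(f,\lambda a.\,\mathrm{id}_{[\mathbf{1}]})$. *)

theory Defs
  imports Main "HOL-Library.FuncSet"
begin

section \<open>Small categories and presheaves\<close>

record ('o, 'm) cat =
  Obj :: "'o set"
  Arr :: "'m set"
  Dom :: "'m \<Rightarrow> 'o"
  Cod :: "'m \<Rightarrow> 'o"
  Idn :: "'o \<Rightarrow> 'm"
  Comp :: "'m \<Rightarrow> 'm \<Rightarrow> 'm"

text \<open>\<open>Comp C g f\<close> is the composite \<open>g \<circ> f\<close>, meaningful when \<open>Cod C f = Dom C g\<close>.\<close>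

definition arrows_to :: "('o, 'm) cat \<Rightarrow> 'o \<Rightarrow> 'm set" where
  "arrows_to C X = {f \<in> Arr C. Cod C f = X}"

definition hom_set :: "('o, 'm) cat \<Rightarrow> 'o \<Rightarrow> 'o \<Rightarrow> 'm set" where
  "hom_set C X Y = {f \<in> Arr C. Dom C f = X \<and> Cod C f = Y}"

definition category :: "('o, 'm) cat \<Rightarrow> bool" where
  "category C \<longleftrightarrow>
     (\<forall>f\<in>Arr C. Dom C f \<in> Obj C \<and> Cod C f \<in> Obj C) \<and>
     (\<forall>X\<in>Obj C. Idn C X \<in> hom_set C X X) \<and>
     (\<forall>g\<in>Arr C. \<forall>f\<in>arrows_to C (Dom C g). Comp C g f \<in> hom_set C (Dom C f) (Cod C g)) \<and>
     (\<forall>f\<in>Arr C. Comp C f (Idn C (Dom C f)) = f \<and> Comp C (Idn C (Cod C f)) f = f) \<and>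
     (\<forall>h\<in>Arr C. \<forall>g\<in>arrows_to C (Dom C h). \<forall>f\<in>arrows_to C (Dom C g).
        Comp C (Comp C h g) f = Comp C h (Comp C g f))"

definition terminal_object :: "('o, 'm) cat \<Rightarrow> 'o \<Rightarrow> bool" where
  "terminal_object C T \<longleftrightarrow> T \<in> Obj C \<and> (\<forall>X\<in>Obj C. \<exists>!f. f \<in> hom_set C X T)"

text \<open>
  \<open>res P f x\<close> is the restriction of \<open>x \<in> P(Cod f)\<close> along \<open>f\<close>. Presheaves over one category may
  have different element types, so the objects of the presheaf category are
  spread over several HOL types.
\<close>

record ('o, 'm, 'e) psh =
  el :: "'o \<Rightarrow> 'e set"
  res :: "'m \<Rightarrow> 'e \<Rightarrow> 'e"

definition presheaf :: "('o, 'm) cat \<Rightarrow> ('o, 'm, 'e) psh \<Rightarrow> bool" where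
  "presheaf C P \<longleftrightarrow>
     (\<forall>f\<in>Arr C. \<forall>x\<in>el P (Cod C f). res P f x \<in> el P (Dom C f)) \<and>
     (\<forall>X\<in>Obj C. \<forall>x\<in>el P X. res P (Idn C X) x = x) \<and>
     (\<forall>g\<in>Arr C. \<forall>f\<in>arrows_to C (Dom C g). \<forall>x\<in>el P (Cod C g).
        res P (Comp C g f) x = res P f (res P g x))"

definition nat_trans ::
  "('o, 'm) cat \<Rightarrow> ('o, 'm, 'e) psh \<Rightarrow> ('o, 'm, 'f) psh \<Rightarrow> ('o \<Rightarrow> 'e \<Rightarrow> 'f) \<Rightarrow> bool" where
  "nat_trans C P Q t \<longleftrightarrow>
     (\<forall>X\<in>Obj C. \<forall>x\<in>el P X. t X x \<in> el Q X) \<and>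
     (\<forall>f\<in>Arr C. \<forall>x\<in>el P (Cod C f). t (Dom C f) (res P f x) = res Q f (t (Cod C f) x))"

text \<open>
  The components of a natural transformation are unconstrained outside the carriers, so two of
  them are identified when they agree on the carriers.
\<close>

definition nat_eq ::
  "('o, 'm) cat \<Rightarrow> ('o, 'm, 'e) psh \<Rightarrow> ('o \<Rightarrow> 'e \<Rightarrow> 'f) \<Rightarrow> ('o \<Rightarrow> 'e \<Rightarrow> 'f) \<Rightarrow> bool" where
  "nat_eq C P s t \<longleftrightarrow> (\<forall>X\<in>Obj C. \<forall>x\<in>el P X. s X x = t X x)"

definition nat_comp :: "('o \<Rightarrow> 'f \<Rightarrow> 'g) \<Rightarrow> ('o \<Rightarrow> 'e \<Rightarrow> 'f) \<Rightarrow> 'o \<Rightarrow> 'e \<Rightarrow> 'g" where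
  "nat_comp t s X x = t X (s X x)"

definition nat_id :: "'o \<Rightarrow> 'e \<Rightarrow> 'e" where
  "nat_id X x = x"

definition yoneda :: "('o, 'm) cat \<Rightarrow> 'o \<Rightarrow> ('o, 'm, 'm) psh" where
  "yoneda C X = \<lparr>el = (\<lambda>Y. hom_set C Y X), res = (\<lambda>f g. Comp C g f)\<rparr>"

definition yoneda_map :: "('o, 'm) cat \<Rightarrow> 'm \<Rightarrow> 'o \<Rightarrow> 'm \<Rightarrow> 'm" where
  "yoneda_map C f Y g = Comp C f g"

text \<open>The map \<open>y(X) \<rightarrow> P\<close> corresponding to an element of \<open>P(X)\<close>.\<close>

definition yoneda_elt :: "('o, 'm, 'e) psh \<Rightarrow> 'e \<Rightarrow> 'o \<Rightarrow> 'm \<Rightarrow> 'e" where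
  "yoneda_elt P x Y f = res P f x"

definition terminal_psh :: "('o, 'm, unit) psh" where
  "terminal_psh = \<lparr>el = (\<lambda>X. {()}), res = (\<lambda>f x. x)\<rparr>"

text \<open>
  The square with top \<open>t : P \<rightarrow> Y\<close>, left \<open>l : P \<rightarrow> X\<close>, bottom \<open>b : X \<rightarrow> Z\<close> and right \<open>r : Y \<rightarrow> Z\<close> is
  a pullback. A HOL definition can only quantify over test presheaves of one fixed element
  type. The type of arrows is chosen because it accommodates all representables; lemma
  \<open>is_pullback_universal\<close> below gives the universal property for test presheaves of every type.
\<close>

definition is_pullback ::
  "('o, 'm) cat \<Rightarrow> ('o, 'm, 'p) psh \<Rightarrow> ('o, 'm, 'y) psh \<Rightarrow> ('o, 'm, 'x) psh \<Rightarrow> ('o, 'm, 'z) psh \<Rightarrow>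
   ('o \<Rightarrow> 'p \<Rightarrow> 'y) \<Rightarrow> ('o \<Rightarrow> 'p \<Rightarrow> 'x) \<Rightarrow> ('o \<Rightarrow> 'x \<Rightarrow> 'z) \<Rightarrow> ('o \<Rightarrow> 'y \<Rightarrow> 'z) \<Rightarrow> bool" where
  "is_pullback C P Y X Z t l b r \<longleftrightarrow>
     nat_trans C P Y t \<and> nat_trans C P X l \<and> nat_trans C X Z b \<and> nat_trans C Y Z r \<and>
     nat_eq C P (nat_comp r t) (nat_comp b l) \<and>
     (\<forall>(T :: ('o, 'm, 'm) psh) u v.
        presheaf C T \<and> nat_trans C T Y u \<and> nat_trans C T X v \<and>
        nat_eq C T (nat_comp r u) (nat_comp b v) \<longrightarrow>
        (\<exists>w. nat_trans C T P w \<and> nat_eq C T (nat_comp t w) u \<and> nat_eq C T (nat_comp l w) v \<and>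
             (\<forall>w'. nat_trans C T P w' \<and> nat_eq C T (nat_comp t w') u \<and>
                   nat_eq C T (nat_comp l w') v \<longrightarrow> nat_eq C T w' w)))"

lemma category_Dom: "category C \<Longrightarrow> f \<in> Arr C \<Longrightarrow> Dom C f \<in> Obj C"
  and category_Cod: "category C \<Longrightarrow> f \<in> Arr C \<Longrightarrow> Cod C f \<in> Obj C"
  and category_Idn: "category C \<Longrightarrow> X \<in> Obj C \<Longrightarrow> Idn C X \<in> Arr C \<and> Dom C (Idn C X) = X \<and> Cod C (Idn C X) = X"
  and category_Comp: "category C \<Longrightarrow> g \<in> Arr C \<Longrightarrow> f \<in> Arr C \<Longrightarrow> Cod C f = Dom C g \<Longrightarrow>
    Comp C g f \<in> Arr C \<and> Dom C (Comp C g f) = Dom C f \<and> Cod C (Comp C g f) = Cod C g"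
  and category_Comp_Idn: "category C \<Longrightarrow> f \<in> Arr C \<Longrightarrow> Dom C f = X \<Longrightarrow> Comp C f (Idn C X) = f"
  and category_Idn_Comp: "category C \<Longrightarrow> f \<in> Arr C \<Longrightarrow> Cod C f = X \<Longrightarrow> Comp C (Idn C X) f = f"
  and category_assoc: "category C \<Longrightarrow> h \<in> Arr C \<Longrightarrow> g \<in> Arr C \<Longrightarrow> f \<in> Arr C \<Longrightarrow>
    Cod C g = Dom C h \<Longrightarrow> Cod C f = Dom C g \<Longrightarrow> Comp C (Comp C h g) f = Comp C h (Comp C g f)"
  by (auto simp: category_def hom_set_def arrows_to_def)

lemmas category_simps = category_Dom category_Cod category_Idn category_Comp
  category_Comp_Idn category_Idn_Comp category_assoc

lemma presheaf_res: "presheaf C P \<Longrightarrow> f \<in> Arr C \<Longrightarrow> Cod C f = X \<Longrightarrow> x \<in> el P X \<Longrightarrow>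
    res P f x \<in> el P (Dom C f)"
  and presheaf_Idn: "presheaf C P \<Longrightarrow> X \<in> Obj C \<Longrightarrow> x \<in> el P X \<Longrightarrow> res P (Idn C X) x = x"
  and presheaf_Comp: "presheaf C P \<Longrightarrow> g \<in> Arr C \<Longrightarrow> f \<in> Arr C \<Longrightarrow> Cod C f = Dom C g \<Longrightarrow>
    x \<in> el P (Cod C g) \<Longrightarrow> res P (Comp C g f) x = res P f (res P g x)"
  by (auto simp: presheaf_def arrows_to_def)

lemma nat_trans_el: "nat_trans C P Q t \<Longrightarrow> X \<in> Obj C \<Longrightarrow> x \<in> el P X \<Longrightarrow> t X x \<in> el Q X"
  and nat_trans_res: "nat_trans C P Q t \<Longrightarrow> f \<in> Arr C \<Longrightarrow> Cod C f = X \<Longrightarrow> x \<in> el P X \<Longrightarrow>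
    t (Dom C f) (res P f x) = res Q f (t X x)"
  by (auto simp: nat_trans_def)

lemma presheaf_yoneda: "category C \<Longrightarrow> presheaf C (yoneda C X)"
  by (auto simp: presheaf_def yoneda_def hom_set_def arrows_to_def category_simps)

lemma nat_trans_yoneda_elt:
  assumes "category C" "presheaf C P" "X \<in> Obj C" "x \<in> el P X"
  shows "nat_trans C (yoneda C X) P (yoneda_elt P x)"
  using assms
  by (auto simp: nat_trans_def yoneda_def yoneda_elt_def hom_set_def presheaf_Comp
      intro: presheaf_res[of C P])

lemma pointwise_universal:
  fixes T :: "('o, 'm, 't) psh"
  assumes C: "category C" and P: "presheaf C P"
    and nt: "nat_trans C P Y t" "nat_trans C P X l"
    and ex1: "\<And>W x y. W \<in> Obj C \<Longrightarrow> x \<in> el X W \<Longrightarrow> y \<in> el Y W \<Longrightarrow> r W y = b W x \<Longrightarrow>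
        \<exists>!z. z \<in> el P W \<and> t W z = y \<and> l W z = x"
    and T: "presheaf C T" "nat_trans C T Y u" "nat_trans C T X v"
       "nat_eq C T (nat_comp r u) (nat_comp b v)"
  shows "\<exists>w. nat_trans C T P w \<and> nat_eq C T (nat_comp t w) u \<and> nat_eq C T (nat_comp l w) v \<and>
       (\<forall>w'. nat_trans C T P w' \<and> nat_eq C T (nat_comp t w') u \<and>
             nat_eq C T (nat_comp l w') v \<longrightarrow> nat_eq C T w' w)"
proof -
  define w where "w = (\<lambda>W s. THE z. z \<in> el P W \<and> t W z = u W s \<and> l W z = v W s)"
  have e: "\<exists>!z. z \<in> el P W \<and> t W z = u W s \<and> l W z = v W s" if "W \<in> Obj C" "s \<in> el T W" for W s
    using that T by (intro ex1) (auto simp: nat_trans_def nat_eq_def nat_comp_def)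
  have w: "w W s \<in> el P W \<and> t W (w W s) = u W s \<and> l W (w W s) = v W s"
    if "W \<in> Obj C" "s \<in> el T W" for W s
    unfolding w_def by (rule theI'[OF e[OF that]])
  have "w (Dom C f) (res T f s) = res P f (w (Cod C f) s)" if f: "f \<in> Arr C" and s: "s \<in> el T (Cod C f)" for f s
  proof -
    have D: "Dom C f \<in> Obj C" "Cod C f \<in> Obj C" "res T f s \<in> el T (Dom C f)"
      using f s C T by (auto simp: category_simps intro: presheaf_res[of C T])
    have "res P f (w (Cod C f) s) \<in> el P (Dom C f)"
      "t (Dom C f) (res P f (w (Cod C f) s)) = u (Dom C f) (res T f s)"
      "l (Dom C f) (res P f (w (Cod C f) s)) = v (Dom C f) (res T f s)"
      using w[OF D(2) s] f s nt T P by (auto intro: presheaf_res[of C P] simp: nat_trans_res)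
    then show ?thesis using w[OF D(1,3)] e[OF D(1,3)] by blast
  qed
  then have "nat_trans C T P w" using w by (auto simp: nat_trans_def)
  moreover have "nat_eq C T w' w" if "nat_trans C T P w'" "nat_eq C T (nat_comp t w') u"
             "nat_eq C T (nat_comp l w') v" for w'
    using that w e unfolding nat_eq_def nat_comp_def nat_trans_def by blast
  moreover have "nat_eq C T (nat_comp t w) u" "nat_eq C T (nat_comp l w) v"
    using w by (auto simp: nat_eq_def nat_comp_def)
  ultimately show ?thesis by blast
qed
lemma is_pullback_iff_pointwise:
  fixes C :: "('o, 'm) cat"
  assumes C: "category C" and P: "presheaf C P" and Y: "presheaf C Y" and X: "presheaf C X"
  shows "is_pullback C P Y X Z t l b r \<longleftrightarrow>
     nat_trans C P Y t \<and> nat_trans C P X l \<and> nat_trans C X Z b \<and> nat_trans C Y Z r \<and>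
     (\<forall>W\<in>Obj C. \<forall>z\<in>el P W. r W (t W z) = b W (l W z)) \<and>
     (\<forall>W\<in>Obj C. \<forall>x\<in>el X W. \<forall>y\<in>el Y W. r W y = b W x \<longrightarrow>
        (\<exists>!z. z \<in> el P W \<and> t W z = y \<and> l W z = x))" (is "?L \<longleftrightarrow> ?R")
proof
  assume L: ?L
  have nt: "nat_trans C P Y t" "nat_trans C P X l" "nat_trans C X Z b" "nat_trans C Y Z r"
    and comm: "\<forall>W\<in>Obj C. \<forall>z\<in>el P W. r W (t W z) = b W (l W z)"
    using L by (auto simp: is_pullback_def nat_eq_def nat_comp_def)
  moreover have "\<exists>!z. z \<in> el P W \<and> t W z = y \<and> l W z = x"
    if W: "W \<in> Obj C" and x: "x \<in> el X W" and y: "y \<in> el Y W" and eq: "r W y = b W x" for W x y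
  proof -
    let ?T = "yoneda C W"
    have rt: "yoneda_elt Q q V f = res Q f q" for Q :: "('o, 'm, 'q) psh" and q V f
      by (simp add: yoneda_elt_def)
    have id: "Idn C W \<in> el ?T W" using C W by (simp add: yoneda_def hom_set_def category_simps)
    have "nat_eq C ?T (nat_comp r (yoneda_elt Y y)) (nat_comp b (yoneda_elt X x))"
      using nt x y eq
      by (auto simp: nat_eq_def nat_comp_def yoneda_def hom_set_def yoneda_elt_def)
        (metis nat_trans_res)
    then obtain w where w: "nat_trans C ?T P w" "nat_eq C ?T (nat_comp t w) (yoneda_elt Y y)"
      "nat_eq C ?T (nat_comp l w) (yoneda_elt X x)"
      and uniq: "\<And>w'. nat_trans C ?T P w' \<Longrightarrow> nat_eq C ?T (nat_comp t w') (yoneda_elt Y y) \<Longrightarrow>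
        nat_eq C ?T (nat_comp l w') (yoneda_elt X x) \<Longrightarrow> nat_eq C ?T w' w"
      using L presheaf_yoneda[OF C, of W] nat_trans_yoneda_elt[OF C Y W y]
        nat_trans_yoneda_elt[OF C X W x]
      unfolding is_pullback_def by metis
    show ?thesis
    proof (rule ex1I[of _ "w W (Idn C W)"])
      show "w W (Idn C W) \<in> el P W \<and> t W (w W (Idn C W)) = y \<and> l W (w W (Idn C W)) = x"
        using w W id x y X Y
        by (auto simp: nat_eq_def nat_comp_def yoneda_elt_def presheaf_Idn nat_trans_def)
    next
      fix z assume z: "z \<in> el P W \<and> t W z = y \<and> l W z = x"
      have "nat_eq C ?T (nat_comp t (yoneda_elt P z)) (yoneda_elt Y y)"
        "nat_eq C ?T (nat_comp l (yoneda_elt P z)) (yoneda_elt X x)"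
        using z nt
        by (auto simp: nat_eq_def nat_comp_def yoneda_def hom_set_def yoneda_elt_def)
          (metis nat_trans_res)+
      then have "nat_eq C ?T (yoneda_elt P z) w"
        using z W by (intro uniq nat_trans_yoneda_elt C P W) auto
      then show "z = w W (Idn C W)"
        using id W P z unfolding nat_eq_def yoneda_elt_def by (metis presheaf_Idn)
    qed
  qed
  ultimately show ?R by blast
next
  assume R: ?R
  have ex1: "\<And>W x y. W \<in> Obj C \<Longrightarrow> x \<in> el X W \<Longrightarrow> y \<in> el Y W \<Longrightarrow> r W y = b W x \<Longrightarrow>
        \<exists>!z. z \<in> el P W \<and> t W z = y \<and> l W z = x"
    and nt: "nat_trans C P Y t" "nat_trans C P X l" using R by blast+
  note pointwise_universal[OF C P nt ex1]
  with R show ?L unfolding is_pullback_def by (auto simp: nat_eq_def[of C P] nat_comp_def[of r t] nat_comp_def[of b l])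
qed


lemma is_pullback_universal:
  fixes T :: "('o, 'm, 't) psh"
  assumes "category C" "presheaf C P" "presheaf C Y" "presheaf C X"
    and pb: "is_pullback C P Y X Z t l b r"
    and "presheaf C T" "nat_trans C T Y u" "nat_trans C T X v"
      "nat_eq C T (nat_comp r u) (nat_comp b v)"
  shows "\<exists>w. nat_trans C T P w \<and> nat_eq C T (nat_comp t w) u \<and> nat_eq C T (nat_comp l w) v \<and>
       (\<forall>w'. nat_trans C T P w' \<and> nat_eq C T (nat_comp t w') u \<and>
             nat_eq C T (nat_comp l w') v \<longrightarrow> nat_eq C T w' w)"
proof -
  note pw = pb[unfolded is_pullback_iff_pointwise[OF assms(1-4)]]
  show ?thesis
    by (rule pointwise_universal[where r = r and b = b and Y = Y and X = X])
      (use assms(1-4,6-) pw in blast)+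
qed


section \<open>Dependent products of presheaves\<close>

text \<open>A morphism \<open>proj : total \<rightarrow> base\<close> of presheaves, regarded as a family over its base.\<close>

record ('o, 'm, 'b, 'a) pfam =
  total :: "('o, 'm, 'b) psh"
  base :: "('o, 'm, 'a) psh"
  proj :: "'o \<Rightarrow> 'b \<Rightarrow> 'a"

definition pfamily :: "('o, 'm) cat \<Rightarrow> ('o, 'm, 'b, 'a) pfam \<Rightarrow> bool" where
  "pfamily C F \<longleftrightarrow> presheaf C (total F) \<and> presheaf C (base F) \<and> nat_trans C (total F) (base F) (proj F)"

text \<open>
  For \<open>a \<in> base(X)\<close>, the fibre over \<open>a\<close> is the pullback of \<open>proj\<close> along \<open>a : y(X) \<rightarrow> base\<close>, an object
  over \<open>y(X)\<close>. Here it is presented as a presheaf on \<open>C/X\<close>: \<open>fibre C F a s\<close> is its value at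
  \<open>s : S \<rightarrow> X\<close>.
\<close>

definition fibre :: "('o, 'm) cat \<Rightarrow> ('o, 'm, 'b, 'a) pfam \<Rightarrow> 'a \<Rightarrow> 'm \<Rightarrow> 'b set" where
  "fibre C F a s = {b \<in> el (total F) (Dom C s). proj F (Dom C s) b = res (base F) s a}"

text \<open>
  The elements at stage \<open>X\<close> of an internal dependent product \<open>\<Prod>d\<in>D. E(d)\<close>, where \<open>D\<close> and \<open>E\<close> live
  over \<open>y(X)\<close>. They are natural families \<open>\<phi>(s, d) \<in> E(s, d)\<close> indexed by \<open>s : S \<rightarrow> X\<close> and \<open>d \<in> D(s)\<close>;
  using extensional functions makes equality of elements the equality of HOL.
\<close>

definition pi_el ::
  "('o, 'm) cat \<Rightarrow> 'o \<Rightarrow> ('m \<Rightarrow> 'd set) \<Rightarrow> ('m \<Rightarrow> 'd \<Rightarrow> 'd) \<Rightarrow>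
   ('m \<Rightarrow> 'd \<Rightarrow> 'e set) \<Rightarrow> ('m \<Rightarrow> 'e \<Rightarrow> 'e) \<Rightarrow> ('m \<times> 'd \<Rightarrow> 'e) set" where
  "pi_el C X D dres E eres =
     {\<phi> \<in> (\<Pi>\<^sub>E (s, d) \<in> (SIGMA s:arrows_to C X. D s). E s d).
        \<forall>s\<in>arrows_to C X. \<forall>r\<in>arrows_to C (Dom C s). \<forall>d\<in>D s.
          \<phi> (Comp C s r, dres r d) = eres r (\<phi> (s, d))}"

definition pi_res :: "('o, 'm) cat \<Rightarrow> 'm \<Rightarrow> ('m \<times> 'd \<Rightarrow> 'e) \<Rightarrow> 'm \<times> 'd \<Rightarrow> 'e" where
  "pi_res C f \<phi> =
     (\<lambda>(s, d). if s \<in> arrows_to C (Dom C f) then \<phi> (Comp C f s, d) else undefined)"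

text \<open>The exponential \<open>B\<^bsub>a'\<^esub>\<^bsup>B\<^sub>a\<^esup>\<close> of fibres of \<open>F\<close>, for \<open>a, a' \<in> base(X)\<close>.\<close>

definition exp_el ::
  "('o, 'm) cat \<Rightarrow> ('o, 'm, 'b, 'a) pfam \<Rightarrow> 'o \<Rightarrow> 'a \<Rightarrow> 'a \<Rightarrow> ('m \<times> 'b \<Rightarrow> 'b) set" where
  "exp_el C F X a a' =
     pi_el C X (fibre C F a) (res (total F)) (\<lambda>s _. fibre C F a' s) (res (total F))"

definition exp_id ::
  "('o, 'm) cat \<Rightarrow> ('o, 'm, 'b, 'a) pfam \<Rightarrow> 'o \<Rightarrow> 'a \<Rightarrow> 'm \<times> 'b \<Rightarrow> 'b" where
  "exp_id C F X a = (\<lambda>(s, b) \<in> (SIGMA s:arrows_to C X. fibre C F a s). b)"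

text \<open>\<open>exp_comp C F X a \<psi> \<phi>\<close> is \<open>\<psi> \<circ> \<phi>\<close> for \<open>\<phi>\<close> with domain the fibre over \<open>a\<close>.\<close>

definition exp_comp ::
  "('o, 'm) cat \<Rightarrow> ('o, 'm, 'b, 'a) pfam \<Rightarrow> 'o \<Rightarrow> 'a \<Rightarrow>
   ('m \<times> 'b \<Rightarrow> 'c) \<Rightarrow> ('m \<times> 'b \<Rightarrow> 'b) \<Rightarrow> 'm \<times> 'b \<Rightarrow> 'c" where
  "exp_comp C F X a \<psi> \<phi> =
     (\<lambda>(s, b) \<in> (SIGMA s:arrows_to C X. fibre C F a s). \<psi> (s, \<phi> (s, b)))"

text \<open>\<open>\<Sum>i\<in>base I. A\<^bsup>J\<^sub>i\<^esup>\<close>, where \<open>J\<^sub>i\<close> is the fibre of \<open>I\<close> over \<open>i\<close>.\<close>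

definition sum_exp ::
  "('o, 'm) cat \<Rightarrow> ('o, 'm, 'j, 'i) pfam \<Rightarrow> ('o, 'm, 'a) psh \<Rightarrow>
   ('o, 'm, 'i \<times> ('m \<times> 'j \<Rightarrow> 'a)) psh" where
  "sum_exp C I A =
     \<lparr>el = (\<lambda>X. {(i, a). i \<in> el (base I) X \<and>
              a \<in> pi_el C X (fibre C I i) (res (total I)) (\<lambda>s _. el A (Dom C s)) (res A)}),
      res = (\<lambda>f (i, a). (res (base I) f i, pi_res C f a))\<rparr>"


section \<open>Internal categories in presheaves\<close>

record ('o, 'm, 'x, 'y) icat =
  iob :: "('o, 'm, 'x) psh"
  imor :: "('o, 'm, 'y) psh"
  isrc :: "'o \<Rightarrow> 'y \<Rightarrow> 'x"
  itgt :: "'o \<Rightarrow> 'y \<Rightarrow> 'x"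
  iid :: "'o \<Rightarrow> 'x \<Rightarrow> 'y"
  icomp :: "'o \<Rightarrow> 'y \<times> 'y \<Rightarrow> 'y"

text \<open>The pullback of \<open>isrc\<close> along \<open>itgt\<close>, with elements \<open>(g, f)\<close> for which \<open>g \<circ> f\<close> is defined.\<close>

definition composable :: "('o, 'm, 'x, 'y) icat \<Rightarrow> ('o, 'm, 'y \<times> 'y) psh" where
  "composable A =
     \<lparr>el = (\<lambda>X. {(g, f). g \<in> el (imor A) X \<and> f \<in> el (imor A) X \<and> isrc A X g = itgt A X f}),
      res = (\<lambda>r (g, f). (res (imor A) r g, res (imor A) r f))\<rparr>"

definition internal_category :: "('o, 'm) cat \<Rightarrow> ('o, 'm, 'x, 'y) icat \<Rightarrow> bool" where
  "internal_category C A \<longleftrightarrow>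
     presheaf C (iob A) \<and> presheaf C (imor A) \<and>
     nat_trans C (imor A) (iob A) (isrc A) \<and> nat_trans C (imor A) (iob A) (itgt A) \<and>
     nat_trans C (iob A) (imor A) (iid A) \<and> nat_trans C (composable A) (imor A) (icomp A) \<and>
     (\<forall>X\<in>Obj C.
        (\<forall>x\<in>el (iob A) X. isrc A X (iid A X x) = x \<and> itgt A X (iid A X x) = x) \<and>
        (\<forall>(g, f)\<in>el (composable A) X.
           isrc A X (icomp A X (g, f)) = isrc A X f \<and>
           itgt A X (icomp A X (g, f)) = itgt A X g) \<and>
        (\<forall>f\<in>el (imor A) X.
           icomp A X (f, iid A X (isrc A X f)) = f \<and> icomp A X (iid A X (itgt A X f), f) = f) \<and>
        (\<forall>h g f. (h, g) \<in> el (composable A) X \<and> (g, f) \<in> el (composable A) X \<longrightarrow>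
           icomp A X (icomp A X (h, g), f) = icomp A X (h, icomp A X (g, f))))"

record ('o, 'x, 'y, 'x2, 'y2) ifun =
  fob :: "'o \<Rightarrow> 'x \<Rightarrow> 'x2"
  fmor :: "'o \<Rightarrow> 'y \<Rightarrow> 'y2"

definition internal_functor ::
  "('o, 'm) cat \<Rightarrow> ('o, 'm, 'x, 'y) icat \<Rightarrow> ('o, 'm, 'x2, 'y2) icat \<Rightarrow>
   ('o, 'x, 'y, 'x2, 'y2) ifun \<Rightarrow> bool" where
  "internal_functor C A B F \<longleftrightarrow>
     nat_trans C (iob A) (iob B) (fob F) \<and> nat_trans C (imor A) (imor B) (fmor F) \<and>
     (\<forall>X\<in>Obj C.
        (\<forall>f\<in>el (imor A) X.
           isrc B X (fmor F X f) = fob F X (isrc A X f) \<and>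
           itgt B X (fmor F X f) = fob F X (itgt A X f)) \<and>
        (\<forall>x\<in>el (iob A) X. fmor F X (iid A X x) = iid B X (fob F X x)) \<and>
        (\<forall>(g, f)\<in>el (composable A) X.
           fmor F X (icomp A X (g, f)) = icomp B X (fmor F X g, fmor F X f)))"

definition ifun_id :: "('o, 'x, 'y, 'x, 'y) ifun" where
  "ifun_id = \<lparr>fob = nat_id, fmor = nat_id\<rparr>"

definition ifun_comp ::
  "('o, 'x2, 'y2, 'x3, 'y3) ifun \<Rightarrow> ('o, 'x, 'y, 'x2, 'y2) ifun \<Rightarrow> ('o, 'x, 'y, 'x3, 'y3) ifun" where
  "ifun_comp G F = \<lparr>fob = nat_comp (fob G) (fob F), fmor = nat_comp (fmor G) (fmor F)\<rparr>"

definition internal_nat_trans ::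
  "('o, 'm) cat \<Rightarrow> ('o, 'm, 'x, 'y) icat \<Rightarrow> ('o, 'm, 'x2, 'y2) icat \<Rightarrow>
   ('o, 'x, 'y, 'x2, 'y2) ifun \<Rightarrow> ('o, 'x, 'y, 'x2, 'y2) ifun \<Rightarrow> ('o \<Rightarrow> 'x \<Rightarrow> 'y2) \<Rightarrow> bool" where
  "internal_nat_trans C A B F G t \<longleftrightarrow>
     nat_trans C (iob A) (imor B) t \<and>
     (\<forall>X\<in>Obj C.
        (\<forall>x\<in>el (iob A) X. isrc B X (t X x) = fob F X x \<and> itgt B X (t X x) = fob G X x) \<and>
        (\<forall>f\<in>el (imor A) X.
           icomp B X (t X (itgt A X f), fmor F X f) = icomp B X (fmor G X f, t X (isrc A X f))))"

definition internal_adjunction ::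
  "('o, 'm) cat \<Rightarrow> ('o, 'm, 'x, 'y) icat \<Rightarrow> ('o, 'm, 'x2, 'y2) icat \<Rightarrow>
   ('o, 'x, 'y, 'x2, 'y2) ifun \<Rightarrow> ('o, 'x2, 'y2, 'x, 'y) ifun \<Rightarrow>
   ('o \<Rightarrow> 'x \<Rightarrow> 'y) \<Rightarrow> ('o \<Rightarrow> 'x2 \<Rightarrow> 'y2) \<Rightarrow> bool" where
  "internal_adjunction C A B F G \<eta> \<epsilon> \<longleftrightarrow>
     internal_functor C A B F \<and> internal_functor C B A G \<and>
     internal_nat_trans C A A ifun_id (ifun_comp G F) \<eta> \<and>
     internal_nat_trans C B B (ifun_comp F G) ifun_id \<epsilon> \<and>
     (\<forall>X\<in>Obj C.
        (\<forall>x\<in>el (iob A) X.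
           icomp B X (\<epsilon> X (fob F X x), fmor F X (\<eta> X x)) = iid B X (fob F X x)) \<and>
        (\<forall>y\<in>el (iob B) X.
           icomp A X (fmor G X (\<epsilon> X y), \<eta> X (fob G X y)) = iid A X (fob G X y)))"

definition has_internal_right_adjoint ::
  "('o, 'm) cat \<Rightarrow> ('o, 'm, 'x, 'y) icat \<Rightarrow> ('o, 'm, 'x2, 'y2) icat \<Rightarrow>
   ('o, 'x, 'y, 'x2, 'y2) ifun \<Rightarrow> bool" where
  "has_internal_right_adjoint C A B F \<longleftrightarrow> (\<exists>G \<eta> \<epsilon>. internal_adjunction C A B F G \<eta> \<epsilon>)"


section \<open>Full internal subcategories and families\<close>

text \<open>A morphism \<open>a \<rightarrow> a'\<close> of \<open>\<S>(F)\<close> is stored as \<open>(a, a', \<phi>)\<close>.\<close>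

definition full_subcat ::
  "('o, 'm) cat \<Rightarrow> ('o, 'm, 'b, 'a) pfam \<Rightarrow> ('o, 'm, 'a, 'a \<times> 'a \<times> ('m \<times> 'b \<Rightarrow> 'b)) icat" where
  "full_subcat C F =
     \<lparr>iob = base F,
      imor =
        \<lparr>el = (\<lambda>X. {(a, a', \<phi>). a \<in> el (base F) X \<and> a' \<in> el (base F) X \<and> \<phi> \<in> exp_el C F X a a'}),
         res = (\<lambda>f (a, a', \<phi>). (res (base F) f a, res (base F) f a', pi_res C f \<phi>))\<rparr>,
      isrc = (\<lambda>X (a, a', \<phi>). a),
      itgt = (\<lambda>X (a, a', \<phi>). a'),
      iid = (\<lambda>X a. (a, a, exp_id C F X a)),
      icomp = (\<lambda>X ((_, a'', \<psi>), (a, _, \<phi>)). (a, a'', exp_comp C F X a \<psi> \<phi>))\<rparr>"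

text \<open>
  \<open>fam C I F\<close> is \<open>Fam\<close> of \<open>full_subcat C F\<close> indexed by \<open>full_subcat C I\<close>. A morphism
  \<open>(i, a) \<rightarrow> (i', a')\<close> is stored as \<open>((i, a), (i', a'), \<alpha>, b)\<close>. For \<open>s : S \<rightarrow> X\<close> and \<open>j\<close> in the fibre
  over \<open>i\<close> at \<open>s\<close>, the component \<open>b (s, j)\<close> is an element at stage \<open>S\<close> of the exponential of the fibres
  of \<open>F\<close> over \<open>a (s, j)\<close> and \<open>a' (s, \<alpha> (s, j))\<close>.
\<close>

type_synonym ('m, 'j, 'i, 'a) fam_ob = "'i \<times> ('m \<times> 'j \<Rightarrow> 'a)"

type_synonym ('m, 'j, 'i, 'b, 'a) fam_mor =
  "('m, 'j, 'i, 'a) fam_ob \<times> ('m, 'j, 'i, 'a) fam_ob \<times>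
   ('m \<times> 'j \<Rightarrow> 'j) \<times> ('m \<times> 'j \<Rightarrow> 'm \<times> 'b \<Rightarrow> 'b)"

definition fam_mor_el ::
  "('o, 'm) cat \<Rightarrow> ('o, 'm, 'j, 'i) pfam \<Rightarrow> ('o, 'm, 'b, 'a) pfam \<Rightarrow> 'o \<Rightarrow>
   ('m, 'j, 'i, 'b, 'a) fam_mor set" where
  "fam_mor_el C I F X =
     {((i, a), (i', a'), \<alpha>, b).
        (i, a) \<in> el (sum_exp C I (base F)) X \<and> (i', a') \<in> el (sum_exp C I (base F)) X \<and>
        \<alpha> \<in> exp_el C I X i i' \<and>
        b \<in> pi_el C X (fibre C I i) (res (total I))
              (\<lambda>s j. exp_el C F (Dom C s) (a (s, j)) (a' (s, \<alpha> (s, j)))) (pi_res C)}"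

definition fam ::
  "('o, 'm) cat \<Rightarrow> ('o, 'm, 'j, 'i) pfam \<Rightarrow> ('o, 'm, 'b, 'a) pfam \<Rightarrow>
   ('o, 'm, ('m, 'j, 'i, 'a) fam_ob, ('m, 'j, 'i, 'b, 'a) fam_mor) icat" where
  "fam C I F =
     \<lparr>iob = sum_exp C I (base F),
      imor =
        \<lparr>el = fam_mor_el C I F,
         res = (\<lambda>f (x, x', \<alpha>, b).
           (res (sum_exp C I (base F)) f x, res (sum_exp C I (base F)) f x',
            pi_res C f \<alpha>, pi_res C f b))\<rparr>,
      isrc = (\<lambda>X (x, x', \<alpha>, b). x),
      itgt = (\<lambda>X (x, x', \<alpha>, b). x'),
      iid = (\<lambda>X (i, a). ((i, a), (i, a), exp_id C I X i,
        \<lambda>(s, j) \<in> (SIGMA s:arrows_to C X. fibre C I i s). exp_id C F (Dom C s) (a (s, j)))),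
      icomp = (\<lambda>X ((_, x'', \<beta>, b'), ((i, a), _, \<alpha>, b)).
        ((i, a), x'', exp_comp C I X i \<beta> \<alpha>,
         \<lambda>(s, j) \<in> (SIGMA s:arrows_to C X. fibre C I i s).
           exp_comp C F (Dom C s) (a (s, j)) (b' (s, \<alpha> (s, j))) (b (s, j))))\<rparr>"


section \<open>Natural models\<close>

text \<open>
  \<open>ty M\<close> is the map \<open>p : \<U>\<^sup>\<bullet> \<rightarrow> \<U>\<close>. The fields \<open>ext\<close>, \<open>prj\<close> and \<open>var\<close> give
  \<open>X \<cdot> A\<close>, \<open>p\<^sub>A\<close> and \<open>q\<^sub>A\<close>.
\<close>

record ('o, 'm, 'v, 'u) nmodel =
  ctx :: "('o, 'm) cat"
  emp :: 'o
  ty :: "('o, 'm, 'v, 'u) pfam"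
  ext :: "'o \<Rightarrow> 'u \<Rightarrow> 'o"
  prj :: "'o \<Rightarrow> 'u \<Rightarrow> 'm"
  var :: "'o \<Rightarrow> 'u \<Rightarrow> 'v"

definition natural_model :: "('o, 'm, 'v, 'u) nmodel \<Rightarrow> bool" where
  "natural_model M \<longleftrightarrow>
     category (ctx M) \<and> terminal_object (ctx M) (emp M) \<and> pfamily (ctx M) (ty M) \<and>
     (\<forall>X\<in>Obj (ctx M). \<forall>A\<in>el (base (ty M)) X.
        ext M X A \<in> Obj (ctx M) \<and>
        prj M X A \<in> hom_set (ctx M) (ext M X A) X \<and>
        var M X A \<in> el (total (ty M)) (ext M X A) \<and>
        is_pullback (ctx M)
          (yoneda (ctx M) (ext M X A)) (total (ty M)) (yoneda (ctx M) X) (base (ty M))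
          (yoneda_elt (total (ty M)) (var M X A)) (yoneda_map (ctx M) (prj M X A))
          (yoneda_elt (base (ty M)) A) (proj (ty M)))"

definition unit_type ::
  "('o, 'm, 'v, 'u) nmodel \<Rightarrow> ('o \<Rightarrow> unit \<Rightarrow> 'u) \<Rightarrow> ('o \<Rightarrow> unit \<Rightarrow> 'v) \<Rightarrow> bool" where
  "unit_type M one star \<longleftrightarrow>
     is_pullback (ctx M) terminal_psh (total (ty M)) terminal_psh (base (ty M))
       star nat_id one (proj (ty M))"

text \<open>\<open>\<Sum>A:\<U>. \<Sum>B:\<U>\<^bsup>[A]\<^esup>. \<Sum>a:[A]. [B(a)]\<close>\<close>

definition pair_psh ::
  "('o, 'm, 'v, 'u) nmodel \<Rightarrow> ('o, 'm, 'u \<times> ('m \<times> 'v \<Rightarrow> 'u) \<times> 'v \<times> 'v) psh" where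
  "pair_psh M =
     \<lparr>el = (\<lambda>X. {(A, B, a, b). (A, B) \<in> el (sum_exp (ctx M) (ty M) (base (ty M))) X \<and>
              a \<in> el (total (ty M)) X \<and> proj (ty M) X a = A \<and>
              b \<in> el (total (ty M)) X \<and> proj (ty M) X b = B (Idn (ctx M) X, a)}),
      res = (\<lambda>f (A, B, a, b). (res (base (ty M)) f A, pi_res (ctx M) f B,
              res (total (ty M)) f a, res (total (ty M)) f b))\<rparr>"

definition pair_proj ::
  "'o \<Rightarrow> 'u \<times> ('m \<times> 'v \<Rightarrow> 'u) \<times> 'v \<times> 'v \<Rightarrow> 'u \<times> ('m \<times> 'v \<Rightarrow> 'u)" where
  "pair_proj X = (\<lambda>(A, B, a, b). (A, B))"

definition admits_dependent_sum_types :: "('o, 'm, 'v, 'u) nmodel \<Rightarrow> bool" where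
  "admits_dependent_sum_types M \<longleftrightarrow>
     (\<exists>Sig pair.
        is_pullback (ctx M) (pair_psh M) (total (ty M))
          (sum_exp (ctx M) (ty M) (base (ty M))) (base (ty M))
          pair pair_proj Sig (proj (ty M)))"

definition type_icat ::
  "('o, 'm, 'v, 'u) nmodel \<Rightarrow> ('o, 'm, 'u, 'u \<times> 'u \<times> ('m \<times> 'v \<Rightarrow> 'v)) icat" where
  "type_icat M = full_subcat (ctx M) (ty M)"

definition type_fam ::
  "('o, 'm, 'v, 'u) nmodel \<Rightarrow>
   ('o, 'm, ('m, 'v, 'u, 'u) fam_ob, ('m, 'v, 'u, 'v, 'u) fam_mor) icat" where
  "type_fam M = fam (ctx M) (ty M) (ty M)"

text \<open>The functor \<open>A \<mapsto> (A, \<one>)\<close>, where \<open>one X ()\<close> is the unit type at stage \<open>X\<close>.\<close>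

definition const_unit ::
  "('o, 'm, 'v, 'u) nmodel \<Rightarrow> ('o \<Rightarrow> unit \<Rightarrow> 'u) \<Rightarrow> 'o \<Rightarrow> 'u \<Rightarrow> 'm \<times> 'v \<Rightarrow> 'u" where
  "const_unit M one X A =
     (\<lambda>(s, a) \<in> (SIGMA s:arrows_to (ctx M) X. fibre (ctx M) (ty M) A s). one (Dom (ctx M) s) ())"

definition diag_functor ::
  "('o, 'm, 'v, 'u) nmodel \<Rightarrow> ('o \<Rightarrow> unit \<Rightarrow> 'u) \<Rightarrow>
   ('o, 'u, 'u \<times> 'u \<times> ('m \<times> 'v \<Rightarrow> 'v),
    ('m, 'v, 'u, 'u) fam_ob, ('m, 'v, 'u, 'v, 'u) fam_mor) ifun" where
  "diag_functor M one =
     \<lparr>fob = (\<lambda>X A. (A, const_unit M one X A)),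
      fmor = (\<lambda>X (A, A', f).
        ((A, const_unit M one X A), (A', const_unit M one X A'), f,
         \<lambda>(s, a) \<in> (SIGMA s:arrows_to (ctx M) X. fibre (ctx M) (ty M) A s).
           exp_id (ctx M) (ty M) (Dom (ctx M) s) (one (Dom (ctx M) s) ())))\<rparr>"


section \<open>Well-definedness of the constructions\<close>

lemma pi_el_iff:
  "\<phi> \<in> pi_el C X D dres E eres \<longleftrightarrow>
     (\<forall>s\<in>arrows_to C X. \<forall>d\<in>D s. \<phi> (s, d) \<in> E s d) \<and>
     (\<forall>s d. \<not> (s \<in> arrows_to C X \<and> d \<in> D s) \<longrightarrow> \<phi> (s, d) = undefined) \<and>
     (\<forall>s\<in>arrows_to C X. \<forall>r\<in>arrows_to C (Dom C s). \<forall>d\<in>D s.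
        \<phi> (Comp C s r, dres r d) = eres r (\<phi> (s, d)))"
  by (auto simp: pi_el_def PiE_def Pi_def extensional_def)

lemma pi_res_el:
  assumes C: "category C" and f: "f \<in> Arr C" and p: "\<phi> \<in> pi_el C (Cod C f) D dres E eres"
    and D: "\<And>s. s \<in> arrows_to C (Dom C f) \<Longrightarrow> D' s = D (Comp C f s)"
    and E: "\<And>s d. s \<in> arrows_to C (Dom C f) \<Longrightarrow> d \<in> D' s \<Longrightarrow> E' s d = E (Comp C f s) d"
  shows "pi_res C f \<phi> \<in> pi_el C (Dom C f) D' dres E' eres"
proof -
  have "Comp C f s \<in> arrows_to C (Cod C f)" if "s \<in> arrows_to C (Dom C f)" for s
    using that C f by (auto simp: arrows_to_def category_simps)
  moreover have "Comp C s r \<in> arrows_to C (Dom C f)" "r \<in> arrows_to C (Dom C (Comp C f s))"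
    "Comp C f (Comp C s r) = Comp C (Comp C f s) r"
    if "s \<in> arrows_to C (Dom C f)" "r \<in> arrows_to C (Dom C s)" for s r
    using that C f by (auto simp: arrows_to_def category_simps)
  ultimately show ?thesis
    using p unfolding pi_el_iff by (auto simp: pi_res_def D E)
qed

lemma fibre_res:
  assumes "category C" "pfamily C F" "f \<in> Arr C" "a \<in> el (base F) (Cod C f)"
    "s \<in> arrows_to C (Dom C f)"
  shows "fibre C F (res (base F) f a) s = fibre C F a (Comp C f s)"
  using assms by (auto simp: fibre_def pfamily_def arrows_to_def category_simps presheaf_Comp)

lemma exp_el_res:
  assumes "category C" "pfamily C F" "f \<in> Arr C" "a \<in> el (base F) (Cod C f)"
    "a' \<in> el (base F) (Cod C f)" "\<phi> \<in> exp_el C F (Cod C f) a a'"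
  shows "pi_res C f \<phi> \<in> exp_el C F (Dom C f) (res (base F) f a) (res (base F) f a')"
  using assms unfolding exp_el_def by (auto intro!: pi_res_el simp: fibre_res)

lemma pi_res_Idn:
  assumes "category C" "X \<in> Obj C" "\<phi> \<in> pi_el C X D dres E eres"
  shows "pi_res C (Idn C X) \<phi> = \<phi>"
  using assms unfolding pi_el_iff
  by (auto simp: pi_res_def fun_eq_iff arrows_to_def category_simps)

lemma pi_res_Comp:
  assumes "category C" "g \<in> Arr C" "f \<in> Arr C" "Cod C f = Dom C g"
  shows "pi_res C (Comp C g f) \<phi> = pi_res C f (pi_res C g \<phi>)"
  using assms by (auto simp: pi_res_def fun_eq_iff arrows_to_def category_simps)

lemma fibre_Comp:
  assumes "category C" "pfamily C F" "s \<in> arrows_to C X" "r \<in> arrows_to C (Dom C s)"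
    "a \<in> el (base F) X" "b \<in> fibre C F a s"
  shows "res (total F) r b \<in> fibre C F a (Comp C s r)"
  using assms
  by (auto simp: fibre_def pfamily_def arrows_to_def category_simps presheaf_Comp nat_trans_res
    intro: presheaf_res[of C "total F"])

lemma exp_id_el:
  assumes "category C" "pfamily C F" "a \<in> el (base F) X"
  shows "exp_id C F X a \<in> exp_el C F X a a"
  using assms unfolding exp_el_def pi_el_iff exp_id_def
  by (auto simp: fibre_Comp) (auto simp: arrows_to_def category_simps)

lemma exp_comp_el:
  assumes "category C" "pfamily C F" "a \<in> el (base F) X" 
    "\<phi> \<in> exp_el C F X a a'"  "\<psi> \<in> exp_el C F X a' a''" 
  shows "exp_comp C F X a \<psi> \<phi> \<in> exp_el C F X a a''"
proof -
  have "Comp C s r \<in> arrows_to C X" if "s \<in> arrows_to C X" "r \<in> arrows_to C (Dom C s)" for s r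
    using that assms(1) by (auto simp: arrows_to_def category_simps)
  then show ?thesis
  using assms unfolding exp_el_def pi_el_iff exp_comp_def
  by (auto simp: fibre_Comp)
qed

lemma exp_id_res:
  assumes "category C" "pfamily C F" "f \<in> Arr C" "a \<in> el (base F) (Cod C f)"
  shows "pi_res C f (exp_id C F (Cod C f) a) = exp_id C F (Dom C f) (res (base F) f a)"
  using assms by (auto simp: pi_res_def exp_id_def fun_eq_iff fibre_res restrict_def)
   (auto simp: arrows_to_def category_simps)

lemma exp_comp_res:
  assumes "category C" "pfamily C F" "f \<in> Arr C" "a \<in> el (base F) (Cod C f)"
  shows "pi_res C f (exp_comp C F (Cod C f) a \<psi> \<phi>) =
    exp_comp C F (Dom C f) (res (base F) f a) (pi_res C f \<psi>) (pi_res C f \<phi>)"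
  using assms by (auto simp: pi_res_def exp_comp_def fun_eq_iff fibre_res restrict_def)
   (auto simp: arrows_to_def category_simps)

lemma exp_comp_id:
  assumes "\<phi> \<in> exp_el C F X a a'"
  shows "exp_comp C F X a \<phi> (exp_id C F X a) = \<phi>" "exp_comp C F X a (exp_id C F X a') \<phi> = \<phi>"
  using assms unfolding exp_el_def pi_el_iff exp_comp_def exp_id_def
  by (auto simp: fun_eq_iff restrict_def)

lemma exp_comp_assoc:
  assumes "\<phi> \<in> exp_el C F X a a'"
  shows "exp_comp C F X a (exp_comp C F X a' \<chi> \<psi>) \<phi> = exp_comp C F X a \<chi> (exp_comp C F X a \<psi> \<phi>)"
  using assms unfolding exp_el_def pi_el_iff exp_comp_def
  by (auto simp: fun_eq_iff restrict_def)

lemma internal_category_full_subcat: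
  assumes C: "category C" and F: "pfamily C F"
  shows "internal_category C (full_subcat C F)"
proof -
  have F': "presheaf C (base F)" using F by (simp add: pfamily_def)
  have i: "pi_res C (Idn C X) \<phi> = \<phi>" if "X \<in> Obj C" "\<phi> \<in> exp_el C F X a a'" for X \<phi> a a'
    using that C unfolding exp_el_def by (blast intro: pi_res_Idn)
  show ?thesis
    unfolding internal_category_def
    using C F F'
    by (auto simp: full_subcat_def presheaf_def[of C "\<lparr>el = _, res = _\<rparr>"] nat_trans_def composable_def
       exp_el_res exp_id_res exp_comp_res exp_id_el exp_comp_el i pi_res_Comp presheaf_Comp presheaf_Idn exp_comp_id exp_comp_assoc
       arrows_to_def intro: presheaf_res[of C "base F"] exp_comp_el)
qed

lemma exp_el_app:
  assumes "\<phi> \<in> exp_el C F X a a'" "s \<in> arrows_to C X" "b \<in> fibre C F a s"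
  shows "\<phi> (s, b) \<in> fibre C F a' s"
  using assms unfolding exp_el_def pi_el_iff by auto

lemma exp_el_nat:
  assumes "\<phi> \<in> exp_el C F X a a'" "s \<in> arrows_to C X" "r \<in> arrows_to C (Dom C s)" "b \<in> fibre C F a s"
  shows "\<phi> (Comp C s r, res (total F) r b) = res (total F) r (\<phi> (s, b))"
  using assms unfolding exp_el_def pi_el_iff by auto

lemma presheaf_sum_exp:
  assumes C: "category C" and I: "pfamily C I" and A: "presheaf C A"
  shows "presheaf C (sum_exp C I A)"
proof -
  have I': "presheaf C (base I)" using I by (simp add: pfamily_def)
  have "pi_res C f a \<in> pi_el C (Dom C f) (fibre C I (res (base I) f i)) (res (total I))
      (\<lambda>s _. el A (Dom C s)) (res A)"
    if "f \<in> Arr C" "i \<in> el (base I) (Cod C f)"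
      "a \<in> pi_el C (Cod C f) (fibre C I i) (res (total I)) (\<lambda>s _. el A (Dom C s)) (res A)" for f i a
    using that C I by (auto intro!: pi_res_el simp: fibre_res) (auto simp: arrows_to_def category_simps)
  then show ?thesis
    using C I' unfolding presheaf_def[of C "sum_exp C I A"]
    by (auto simp: sum_exp_def presheaf_Idn presheaf_Comp
      pi_res_Comp arrows_to_def intro: pi_res_Idn presheaf_res[of C "base I"])
qed

lemma sum_exp_app:
  assumes "(i, a) \<in> el (sum_exp C I A) X" "s \<in> arrows_to C X" "j \<in> fibre C I i s"
  shows "a (s, j) \<in> el A (Dom C s)"
  using assms by (auto simp: sum_exp_def pi_el_iff)

lemma sum_exp_nat:
  assumes "(i, a) \<in> el (sum_exp C I A) X" "s \<in> arrows_to C X" "r \<in> arrows_to C (Dom C s)" "j \<in> fibre C I i s"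
  shows "a (Comp C s r, res (total I) r j) = res A r (a (s, j))"
  using assms by (auto simp: sum_exp_def pi_el_iff)

lemma arrows_to_Comp:
  assumes "category C" "s \<in> arrows_to C X" "r \<in> arrows_to C (Dom C s)"
  shows "Comp C s r \<in> arrows_to C X" "Dom C (Comp C s r) = Dom C r"
    using assms by (auto simp: arrows_to_def category_simps)

lemma fam_mor_el_iff:
  "(x, x', \<alpha>, b) \<in> fam_mor_el C I F X \<longleftrightarrow>
     x \<in> el (sum_exp C I (base F)) X \<and> x' \<in> el (sum_exp C I (base F)) X \<and>
     \<alpha> \<in> exp_el C I X (fst x) (fst x') \<and>
     (\<forall>s\<in>arrows_to C X. \<forall>j\<in>fibre C I (fst x) s. b (s, j) \<in> exp_el C F (Dom C s) (snd x (s, j)) (snd x' (s, \<alpha> (s, j)))) \<and>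
     (\<forall>s j. \<not> (s \<in> arrows_to C X \<and> j \<in> fibre C I (fst x) s) \<longrightarrow> b (s, j) = undefined) \<and>
     (\<forall>s\<in>arrows_to C X. \<forall>r\<in>arrows_to C (Dom C s). \<forall>j\<in>fibre C I (fst x) s.
        b (Comp C s r, res (total I) r j) = pi_res C r (b (s, j)))"
  by (cases x; cases x') (simp add: fam_mor_el_def pi_el_iff)

lemma fam_res_el:
  assumes C: "category C" and I: "pfamily C I" and F: "pfamily C F" and f: "f \<in> Arr C"
    and x: "(x, x', \<alpha>, b) \<in> fam_mor_el C I F (Cod C f)"
  shows "(res (sum_exp C I (base F)) f x, res (sum_exp C I (base F)) f x',
            pi_res C f \<alpha>, pi_res C f b) \<in> fam_mor_el C I F (Dom C f)"
proof -
  obtain i a i' a' where [simp]: "x = (i, a)" "x' = (i', a')" by fastforce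
  have ps: "presheaf C (sum_exp C I (base F))" using C I F by (simp add: presheaf_sum_exp pfamily_def)
  have m: "(i, a) \<in> el (sum_exp C I (base F)) (Cod C f)" "(i', a') \<in> el (sum_exp C I (base F)) (Cod C f)"
    "\<alpha> \<in> exp_el C I (Cod C f) i i'"
    "b \<in> pi_el C (Cod C f) (fibre C I i) (res (total I))
              (\<lambda>s j. exp_el C F (Dom C s) (a (s, j)) (a' (s, \<alpha> (s, j)))) (pi_res C)"
    using x by (auto simp: fam_mor_el_def)
  have i: "i \<in> el (base I) (Cod C f)" "i' \<in> el (base I) (Cod C f)" using m by (auto simp: sum_exp_def)
  have "res (sum_exp C I (base F)) f (i, a) \<in> el (sum_exp C I (base F)) (Dom C f)"
    "res (sum_exp C I (base F)) f (i', a') \<in> el (sum_exp C I (base F)) (Dom C f)"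
    using m f presheaf_res[OF ps f] by auto
  moreover have "pi_res C f \<alpha> \<in> exp_el C I (Dom C f) (res (base I) f i) (res (base I) f i')"
    using C I f i m by (intro exp_el_res)
  moreover have "pi_res C f b \<in> pi_el C (Dom C f) (fibre C I (res (base I) f i)) (res (total I))
      (\<lambda>s j. exp_el C F (Dom C s) (pi_res C f a (s, j)) (pi_res C f a' (s, pi_res C f \<alpha> (s, j)))) (pi_res C)"
    using C I f i by (intro pi_res_el[OF C f m(4)]) (auto simp: fibre_res pi_res_def, 
       (auto simp: arrows_to_def category_simps))
  ultimately show ?thesis by (simp add: fam_mor_el_def sum_exp_def)
qed

lemma fam_id_el:
  assumes C: "category C" and I: "pfamily C I" and F: "pfamily C F" and X: "X \<in> Obj C"
    and x: "x \<in> el (sum_exp C I (base F)) X"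
  shows "iid (fam C I F) X x \<in> fam_mor_el C I F X"
proof -
  obtain i a where [simp]: "x = (i, a)" by fastforce
  have i: "i \<in> el (base I) X" using x by (auto simp: sum_exp_def)
  note x' = x[simplified]
  have 1: "exp_id C I X i (s, j) = j" if "s \<in> arrows_to C X" "j \<in> fibre C I i s" for s j
    using that by (simp add: exp_id_def)
  have 2: "exp_id C F (Dom C r) (a (Comp C s r, res (total I) r j)) = pi_res C r (exp_id C F (Dom C s) (a (s, j)))"
    if "s \<in> arrows_to C X" "r \<in> arrows_to C (Dom C s)" "j \<in> fibre C I i s" for s r j
    using exp_id_res[OF C F, of r "a (s, j)"] sum_exp_nat[OF x' that] sum_exp_app[OF x' that(1,3)]
      arrows_to_Comp[OF C that(1,2)] that(2)
    by (auto simp: arrows_to_def)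
  show ?thesis using x' exp_id_el[OF C I i]
    by (auto simp: fam_def fam_mor_el_iff 1 2 fibre_Comp[OF C I _ _ i] arrows_to_Comp[OF C] intro!: exp_id_el[OF C F] sum_exp_app[OF x'])
qed

lemma fam_comp_el:
  assumes C: "category C" and I: "pfamily C I" and F: "pfamily C F" and X: "X \<in> Obj C"
    and f: "(x, x', \<alpha>, b) \<in> fam_mor_el C I F X" and g: "(x', x'', \<beta>, b') \<in> fam_mor_el C I F X"
  shows "icomp (fam C I F) X ((x', x'', \<beta>, b'), (x, x', \<alpha>, b)) \<in> fam_mor_el C I F X"
proof -
  obtain i a i' a' i'' a'' where [simp]: "x = (i, a)" "x' = (i', a')" "x'' = (i'', a'')" by (metis surj_pair)
  note f' = f[unfolded fam_mor_el_iff, simplified] and g' = g[unfolded fam_mor_el_iff, simplified]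
  have i: "i \<in> el (base I) X" using f' by (auto simp: sum_exp_def)
  have x: "(i, a) \<in> el (sum_exp C I (base F)) X" using f' by simp
  have al: "\<alpha> \<in> exp_el C I X i i'" using f' by blast
  have 1: "exp_comp C I X i \<beta> \<alpha> (s, j) = \<beta> (s, \<alpha> (s, j))" if "s \<in> arrows_to C X" "j \<in> fibre C I i s" for s j
    using that by (simp add: exp_comp_def)
  have 2: "exp_comp C F (Dom C r) (a (Comp C s r, res (total I) r j)) (b' (Comp C s r, \<alpha> (Comp C s r, res (total I) r j))) (b (Comp C s r, res (total I) r j))
     = pi_res C r (exp_comp C F (Dom C s) (a (s, j)) (b' (s, \<alpha> (s, j))) (b (s, j)))"
    if "s \<in> arrows_to C X" "r \<in> arrows_to C (Dom C s)" "j \<in> fibre C I i s" for s r j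
  proof -
    have "Cod C r = Dom C s" "r \<in> Arr C" using that by (auto simp: arrows_to_def)
    moreover have "b' (Comp C s r, res (total I) r (\<alpha> (s, j))) = pi_res C r (b' (s, \<alpha> (s, j)))"
      "b (Comp C s r, res (total I) r j) = pi_res C r (b (s, j))"
      using f' g' that exp_el_app[OF al that(1,3)] by blast+
    ultimately show ?thesis
      using exp_comp_res[OF C F, of r "a (s, j)" "b' (s, \<alpha> (s, j))" "b (s, j)"] sum_exp_nat[OF x that] sum_exp_app[OF x that(1,3)]
        exp_el_nat[OF al that]
      by simp
  qed
  have 3: "exp_comp C F (Dom C r) (a (Comp C s r, res (total I) r j)) (b' (Comp C s r, \<alpha> (Comp C s r, res (total I) r j))) (pi_res C r (b (s, j)))
     = pi_res C r (exp_comp C F (Dom C s) (a (s, j)) (b' (s, \<alpha> (s, j))) (b (s, j)))"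
    if "s \<in> arrows_to C X" "r \<in> arrows_to C (Dom C s)" "j \<in> fibre C I i s" for s r j
    using 2[OF that] f' that by simp
  show ?thesis using f' g' exp_comp_el[OF C I i]
    by (auto simp: fam_def fam_mor_el_iff 1 3 fibre_Comp[OF C I _ _ i] arrows_to_Comp[OF C] exp_el_app[OF al] intro!: exp_comp_el[OF C F] sum_exp_app[OF x])
qed

lemma fam_id_res:
  assumes C: "category C" and I: "pfamily C I" and F: "pfamily C F" and f: "f \<in> Arr C"
    and x: "x \<in> el (sum_exp C I (base F)) (Cod C f)"
  shows "res (imor (fam C I F)) f (iid (fam C I F) (Cod C f) x) = iid (fam C I F) (Dom C f) (res (sum_exp C I (base F)) f x)"
proof -
  obtain i a where [simp]: "x = (i, a)" by fastforce
  have i: "i \<in> el (base I) (Cod C f)" using x by (auto simp: sum_exp_def)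
  show ?thesis
    using exp_id_res[OF C I f i] C I f i
    by (auto simp: fam_def sum_exp_def fun_eq_iff restrict_def fibre_res pi_res_def)
      (auto simp: arrows_to_def category_simps)
qed

lemma fam_comp_res:
  assumes C: "category C" and I: "pfamily C I" and F: "pfamily C F" and f: "f \<in> Arr C"
    and x: "(x, x', \<alpha>, b) \<in> fam_mor_el C I F (Cod C f)"
  shows "res (imor (fam C I F)) f (icomp (fam C I F) (Cod C f) ((x', x'', \<beta>, b'), (x, x', \<alpha>, b))) =
    icomp (fam C I F) (Dom C f) (res (imor (fam C I F)) f (x', x'', \<beta>, b'), res (imor (fam C I F)) f (x, x', \<alpha>, b))"
proof -
  obtain i a where [simp]: "x = (i, a)" by fastforce
  have i: "i \<in> el (base I) (Cod C f)" using x by (auto simp: sum_exp_def fam_mor_el_def)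
  have "pi_res C f (\<lambda>(s, j) \<in> (SIGMA s:arrows_to C (Cod C f). fibre C I i s).
           exp_comp C F (Dom C s) (a (s, j)) (b' (s, \<alpha> (s, j))) (b (s, j))) =
      (\<lambda>(s, j) \<in> (SIGMA s:arrows_to C (Dom C f). fibre C I (res (base I) f i) s).
           exp_comp C F (Dom C s) (pi_res C f a (s, j)) (pi_res C f b' (s, pi_res C f \<alpha> (s, j)))
             (pi_res C f b (s, j)))"
    using C I f i
    by (auto simp: fun_eq_iff restrict_def fibre_res pi_res_def)
      (auto simp: arrows_to_def category_simps)
  then show ?thesis
    using exp_comp_res[OF C I f i] by (auto simp: fam_def sum_exp_def split: prod.splits)
qed

lemma fam_comp_id:
  assumes x: "(x, x', \<alpha>, b) \<in> fam_mor_el C I F X" 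
  shows "icomp (fam C I F) X ((x, x', \<alpha>, b), iid (fam C I F) X x) = (x, x', \<alpha>, b)"
    "icomp (fam C I F) X (iid (fam C I F) X x', (x, x', \<alpha>, b)) = (x, x', \<alpha>, b)"
proof -
  obtain i a i' a' where [simp]: "x = (i, a)" "x' = (i', a')" by (metis surj_pair)
  note f' = x[unfolded fam_mor_el_iff, simplified]
  have al: "\<alpha> \<in> exp_el C I X i i'" using f' by blast
  have 2: "b (s, j) \<in> exp_el C F (Dom C s) (a (s, j)) (a' (s, \<alpha> (s, j)))" if "s \<in> arrows_to C X" "j \<in> fibre C I i s" for s j
    using that f' by blast
  have 3: "b (s, j) = undefined" if "\<not> (s \<in> arrows_to C X \<and> j \<in> fibre C I i s)" for s j
    using that f' by blast
  have 4: "exp_id C I X i (s, j) = j" if "s \<in> arrows_to C X" "j \<in> fibre C I i s" for s j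
    using that by (simp add: exp_id_def)
  show "icomp (fam C I F) X ((x, x', \<alpha>, b), iid (fam C I F) X x) = (x, x', \<alpha>, b)"
    "icomp (fam C I F) X (iid (fam C I F) X x', (x, x', \<alpha>, b)) = (x, x', \<alpha>, b)"
    using exp_comp_id[OF al] exp_el_app[OF al]
    by (auto simp: fam_def fun_eq_iff restrict_def exp_comp_id[OF 2] 3 4)
qed

lemma fam_comp_assoc:
  assumes x: "(x, x', \<alpha>, b) \<in> fam_mor_el C I F X" and y: "(x', x'', \<beta>, b') \<in> fam_mor_el C I F X"
    and z: "(x'', x3, \<gamma>, b'') \<in> fam_mor_el C I F X"
  shows "icomp (fam C I F) X (icomp (fam C I F) X ((x'', x3, \<gamma>, b''), (x', x'', \<beta>, b')), (x, x', \<alpha>, b)) =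
     icomp (fam C I F) X ((x'', x3, \<gamma>, b''), icomp (fam C I F) X ((x', x'', \<beta>, b'), (x, x', \<alpha>, b)))"
proof -
  obtain i a i' a' i'' a'' where [simp]: "x = (i, a)" "x' = (i', a')" "x'' = (i'', a'')" by (metis surj_pair)
  note f' = x[unfolded fam_mor_el_iff, simplified] and g' = y[unfolded fam_mor_el_iff, simplified]
  have al: "\<alpha> \<in> exp_el C I X i i'" using f' by blast
  have 1: "exp_comp C I X i \<beta> \<alpha> (s, j) = \<beta> (s, \<alpha> (s, j))" if "s \<in> arrows_to C X" "j \<in> fibre C I i s" for s j
    using that by (simp add: exp_comp_def)
  have 2: "b (s, j) \<in> exp_el C F (Dom C s) (a (s, j)) (a' (s, \<alpha> (s, j)))" if "s \<in> arrows_to C X" "j \<in> fibre C I i s" for s j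
    using that f' by blast
  show ?thesis using exp_comp_assoc[OF al] exp_el_app[OF al]
    by (auto simp: fam_def fun_eq_iff restrict_def 1 exp_comp_assoc[OF 2])
qed

lemma fam_sel:
  "iob (fam C I F) = sum_exp C I (base F)" "el (imor (fam C I F)) = fam_mor_el C I F"
  "isrc (fam C I F) X (x, r) = x" "itgt (fam C I F) X (x, x', q) = x'"
  "res (imor (fam C I F)) f (x, x', \<alpha>, b) = (res (sum_exp C I (base F)) f x, res (sum_exp C I (base F)) f x',
            pi_res C f \<alpha>, pi_res C f b)"
  by (auto simp: fam_def split: prod.splits)

lemma fam_comp_src:
  "isrc (fam C I F) X (icomp (fam C I F) X (g, f)) = isrc (fam C I F) X f"
  "itgt (fam C I F) X (icomp (fam C I F) X (g, f)) = itgt (fam C I F) X g"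
  "isrc (fam C I F) X (iid (fam C I F) X x) = x"
  "itgt (fam C I F) X (iid (fam C I F) X x) = x"
  by (auto simp: fam_def split: prod.splits)

lemma internal_category_fam:
  assumes C: "category C" and I: "pfamily C I" and F: "pfamily C F"
  shows "internal_category C (fam C I F)"
proof -
  have ps: "presheaf C (sum_exp C I (base F))" using C I F by (simp add: presheaf_sum_exp pfamily_def)
  have o: "x \<in> el (sum_exp C I (base F)) X" "x' \<in> el (sum_exp C I (base F)) X"
    if "(x, x', \<alpha>, b) \<in> fam_mor_el C I F X" for x x' \<alpha> b X
    using that by (auto simp: fam_mor_el_iff)
  have id: "pi_res C (Idn C X) \<alpha> = \<alpha>" "pi_res C (Idn C X) b = b" 
     if "(x, x', \<alpha>, b) \<in> fam_mor_el C I F X" "X \<in> Obj C" for x x' \<alpha> b X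
    using that C by (auto simp: fam_mor_el_def exp_el_def intro: pi_res_Idn)
  have "presheaf C (imor (fam C I F))"
    unfolding presheaf_def
    using C I F ps by (auto simp: fam_sel fam_res_el id presheaf_Idn[OF ps] o presheaf_Comp[OF ps] pi_res_Comp arrows_to_def)
  moreover have "nat_trans C (imor (fam C I F)) (iob (fam C I F)) (isrc (fam C I F))"
     "nat_trans C (imor (fam C I F)) (iob (fam C I F)) (itgt (fam C I F))"
    by (auto simp: nat_trans_def fam_sel o)
  moreover have "nat_trans C (iob (fam C I F)) (imor (fam C I F)) (iid (fam C I F))"
    using C I F by (auto simp: nat_trans_def fam_sel(1-4) fam_id_el fam_id_res)
  moreover have "nat_trans C (composable (fam C I F)) (imor (fam C I F)) (icomp (fam C I F))"
    using C I F by (auto simp: nat_trans_def fam_sel(1-4) composable_def fam_comp_el fam_comp_res category_simps)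
  ultimately show ?thesis
    unfolding internal_category_def using ps
    by (auto simp: fam_comp_src) (auto simp: fam_sel composable_def fam_comp_id fam_comp_assoc)
qed

lemma internal_functor_diag_functor:
  assumes M: "natural_model M" and u: "unit_type M one star"
  shows "internal_functor (ctx M) (type_icat M) (type_fam M) (diag_functor M one)"
proof -
  let ?C = "ctx M" and ?F = "ty M"
  have C: "category ?C" and F: "pfamily ?C ?F" using M by (auto simp: natural_model_def)
  have F': "presheaf ?C (base ?F)" using F by (simp add: pfamily_def)
  have one: "nat_trans ?C terminal_psh (base ?F) one" using u by (auto simp: unit_type_def is_pullback_def)
  have one_el: "one X () \<in> el (base ?F) X" if "X \<in> Obj ?C" for X
    using nat_trans_el[OF one that] by (simp add: terminal_psh_def)
  have one_res: "res (base ?F) r (one Y ()) = one (Dom ?C r) ()" if "r \<in> arrows_to ?C Y" for r Y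
    using nat_trans_res[OF one, of r Y "()"] that by (auto simp: terminal_psh_def arrows_to_def)
  have Do: "Dom ?C s \<in> Obj ?C" "s \<in> Arr ?C" if "s \<in> arrows_to ?C X" for s X
    using that C by (auto simp: arrows_to_def category_simps)
  have cu: "(A, const_unit M one X A) \<in> el (sum_exp ?C ?F (base ?F)) X"
    if A: "A \<in> el (base ?F) X" for X A
    using A one_el Do(1) fibre_Comp[OF C F _ _ A] arrows_to_Comp[OF C]
    by (simp add: sum_exp_def pi_el_iff const_unit_def one_res)
  have cu_res: "res (sum_exp ?C ?F (base ?F)) f (A, const_unit M one (Cod ?C f) A) =
     (res (base ?F) f A, const_unit M one (Dom ?C f) (res (base ?F) f A))"
    if "f \<in> Arr ?C" "A \<in> el (base ?F) (Cod ?C f)" for f A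
    using that C F
    by (auto simp: sum_exp_def const_unit_def fun_eq_iff pi_res_def fibre_res restrict_def)
      (auto simp: arrows_to_def category_simps)
  have mor: "fmor (diag_functor M one) X (A, A', f) \<in> fam_mor_el ?C ?F ?F X"
    if "A \<in> el (base ?F) X" "A' \<in> el (base ?F) X" "f \<in> exp_el ?C ?F X A A'" for X A A' f
  proof -
    have "pi_res ?C r (exp_id ?C ?F Y (one Y ())) = exp_id ?C ?F (Dom ?C r) (one (Dom ?C r) ())"
      if "r \<in> arrows_to ?C Y" for r Y
      using that exp_id_res[OF C F, of r "one Y ()"] one_el[of Y] C one_res[OF that]
      by (auto simp: arrows_to_def category_simps)
    moreover have "exp_id ?C ?F (Dom ?C s) (one (Dom ?C s) ()) \<in>
        exp_el ?C ?F (Dom ?C s) (one (Dom ?C s) ()) (one (Dom ?C s) ())" if "s \<in> arrows_to ?C X" for s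
      using exp_id_el[OF C F one_el[OF Do(1)[OF that]]] .
    ultimately show ?thesis
      using cu[OF that(1)] cu[OF that(2)] that(3) fibre_Comp[OF C F _ _ that(1)] arrows_to_Comp[OF C]
        exp_el_app[OF that(3)]
      by (simp add: diag_functor_def fam_mor_el_iff const_unit_def)
  qed
  show ?thesis
  proof -
    have "nat_trans ?C (iob (type_icat M)) (iob (type_fam M)) (fob (diag_functor M one))"
      by (auto simp: nat_trans_def type_icat_def type_fam_def full_subcat_def fam_sel diag_functor_def cu cu_res)
    moreover have "nat_trans ?C (imor (type_icat M)) (imor (type_fam M)) (fmor (diag_functor M one))"
    proof -
      have "pi_res ?C f (\<lambda>(s, a) \<in> (SIGMA s:arrows_to ?C (Cod ?C f). fibre ?C ?F A s).
             exp_id ?C ?F (Dom ?C s) (one (Dom ?C s) ())) =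
         (\<lambda>(s, a) \<in> (SIGMA s:arrows_to ?C (Dom ?C f). fibre ?C ?F (res (base ?F) f A) s).
             exp_id ?C ?F (Dom ?C s) (one (Dom ?C s) ()))"
        if "f \<in> Arr ?C" "A \<in> el (base ?F) (Cod ?C f)" for f A
        using that C F
        by (auto simp: fun_eq_iff restrict_def fibre_res pi_res_def)
          (auto simp: arrows_to_def category_simps)
      then have "fmor (diag_functor M one) (Dom ?C f) (res (base ?F) f A, res (base ?F) f A', pi_res ?C f \<phi>) =
          res (imor (fam ?C ?F ?F)) f (fmor (diag_functor M one) (Cod ?C f) (A, A', \<phi>))"
        if "f \<in> Arr ?C" "A \<in> el (base ?F) (Cod ?C f)" "A' \<in> el (base ?F) (Cod ?C f)" for f A A' \<phi>
        using that by (simp add: diag_functor_def fam_sel cu_res)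
      then show ?thesis using mor
        by (simp add: nat_trans_def type_icat_def type_fam_def full_subcat_def fam_sel(2) split: prod.splits)
    qed
    moreover have "exp_comp ?C ?F X e (exp_id ?C ?F X e) (exp_id ?C ?F X e) = exp_id ?C ?F X e" for X e
      by (auto simp: exp_comp_def exp_id_def fun_eq_iff restrict_def)
    ultimately show ?thesis unfolding internal_functor_def
      by (auto simp: type_icat_def type_fam_def fam_sel full_subcat_def diag_functor_def composable_def)
       (auto simp: fam_def const_unit_def fun_eq_iff restrict_def exp_el_app)
  qed
qed

lemma presheaf_pair_psh:
  assumes M: "natural_model M"
  shows "presheaf (ctx M) (pair_psh M)"
    and "nat_trans (ctx M) (pair_psh M) (sum_exp (ctx M) (ty M) (base (ty M))) pair_proj"
proof -
  let ?C = "ctx M" and ?F = "ty M"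
  let ?S = "sum_exp ?C ?F (base ?F)"
  have C: "category ?C" and F: "pfamily ?C ?F" using M by (auto simp: natural_model_def)
  have F': "presheaf ?C (base ?F)" "presheaf ?C (total ?F)"
    and p: "nat_trans ?C (total ?F) (base ?F) (proj ?F)" using F by (auto simp: pfamily_def)
  have S: "presheaf ?C ?S" using C F F' by (simp add: presheaf_sum_exp)
  have S_res: "res ?S f (A, B) = (res (base ?F) f A, pi_res ?C f B)" for f A B
    by (simp add: sum_exp_def)
  have nat: "pi_res ?C f B (Idn ?C (Dom ?C f), res (total ?F) f a) =
      res (base ?F) f (B (Idn ?C (Cod ?C f), a))"
    if f: "f \<in> Arr ?C" and AB: "(A, B) \<in> el ?S (Cod ?C f)"
      and a: "a \<in> el (total ?F) (Cod ?C f)" "proj ?F (Cod ?C f) a = A" for f A B a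
  proof -
    have A: "A \<in> el (base ?F) (Cod ?C f)" using AB by (simp add: sum_exp_def)
    have "Idn ?C (Cod ?C f) \<in> arrows_to ?C (Cod ?C f)"
      "f \<in> arrows_to ?C (Dom ?C (Idn ?C (Cod ?C f)))"
      "a \<in> fibre ?C ?F A (Idn ?C (Cod ?C f))"
      using C f a A by (auto simp: arrows_to_def category_simps fibre_def presheaf_Idn[OF F'(1)])
    from sum_exp_nat[OF AB this] show ?thesis
      using C f by (simp add: pi_res_def arrows_to_def category_simps)
  qed
  show "presheaf ?C (pair_psh M)"
    unfolding presheaf_def
  proof (intro conjI ballI)
    fix f x assume f: "f \<in> Arr ?C" and x: "x \<in> el (pair_psh M) (Cod ?C f)"
    obtain A B a b where x_eq: "x = (A, B, a, b)" by (metis surj_pair)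
    have AB: "(A, B) \<in> el ?S (Cod ?C f)"
      and a: "a \<in> el (total ?F) (Cod ?C f)" "proj ?F (Cod ?C f) a = A"
      and b: "b \<in> el (total ?F) (Cod ?C f)" "proj ?F (Cod ?C f) b = B (Idn ?C (Cod ?C f), a)"
      using x by (auto simp: x_eq pair_psh_def)
    have "(res (base ?F) f A, pi_res ?C f B) \<in> el ?S (Dom ?C f)"
      using presheaf_res[OF S f refl AB] by (simp only: S_res)
    moreover have "res (total ?F) f a \<in> el (total ?F) (Dom ?C f)"
      "res (total ?F) f b \<in> el (total ?F) (Dom ?C f)"
      using presheaf_res[OF F'(2) f refl] a(1) b(1) by blast+
    moreover have "proj ?F (Dom ?C f) (res (total ?F) f a) = res (base ?F) f A"
      by (simp only: nat_trans_res[OF p f refl a(1)] a(2))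
    moreover have "proj ?F (Dom ?C f) (res (total ?F) f b) =
        pi_res ?C f B (Idn ?C (Dom ?C f), res (total ?F) f a)"
      by (simp only: nat_trans_res[OF p f refl b(1)] b(2) nat[OF f AB a])
    ultimately show "res (pair_psh M) f x \<in> el (pair_psh M) (Dom ?C f)"
      by (simp add: x_eq pair_psh_def)
  next
    fix X x assume X: "X \<in> Obj ?C" and x: "x \<in> el (pair_psh M) X"
    obtain A B a b where x_eq: "x = (A, B, a, b)" by (metis surj_pair)
    have AB: "(A, B) \<in> el ?S X" and ab: "a \<in> el (total ?F) X" "b \<in> el (total ?F) X"
      using x by (auto simp: x_eq pair_psh_def)
    show "res (pair_psh M) (Idn ?C X) x = x"
      using presheaf_Idn[OF S X AB] presheaf_Idn[OF F'(2) X ab(1)] presheaf_Idn[OF F'(2) X ab(2)]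
      by (simp add: x_eq pair_psh_def S_res)
  next
    fix g f x assume g: "g \<in> Arr ?C" and f: "f \<in> arrows_to ?C (Dom ?C g)"
      and x: "x \<in> el (pair_psh M) (Cod ?C g)"
    obtain A B a b where x_eq: "x = (A, B, a, b)" by (metis surj_pair)
    have AB: "(A, B) \<in> el ?S (Cod ?C g)"
      and ab: "a \<in> el (total ?F) (Cod ?C g)" "b \<in> el (total ?F) (Cod ?C g)"
      using x by (auto simp: x_eq pair_psh_def)
    have f': "f \<in> Arr ?C" "Cod ?C f = Dom ?C g" using f by (auto simp: arrows_to_def)
    show "res (pair_psh M) (Comp ?C g f) x = res (pair_psh M) f (res (pair_psh M) g x)"
      using presheaf_Comp[OF S g f' AB] presheaf_Comp[OF F'(2) g f' ab(1)]
        presheaf_Comp[OF F'(2) g f' ab(2)]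
      by (simp add: x_eq pair_psh_def S_res)
  qed
  show "nat_trans ?C (pair_psh M) ?S pair_proj"
    by (auto simp: nat_trans_def pair_psh_def pair_proj_def S_res)
qed

end

theory Submission
  imports Defs
begin

text \<open>
  A morphism \<open>\<Delta> T \<rightarrow> (A, B)\<close> in \<open>Fam\<close> consists of a map \<open>f : [T] \<rightarrow> [A]\<close> and maps
  \<open>[\<one>] \<rightarrow> [B (f t)]\<close> for \<open>t \<in> [T]\<close>, hence it is a map from \<open>[T]\<close> to \<open>\<Sum>a:[A]. [B a]\<close>, and
  composition with \<open>\<Delta> k\<close> is composition with \<open>k\<close>. A right adjoint of \<open>\<Delta>\<close> with its counit is therefore the same as types
  \<open>\<Sigma>(A, B)\<close> with maps \<open>[\<Sigma>(A, B)] \<rightarrow> \<Sum>a:[A]. [B a]\<close> that induce bijections on maps out of every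
  \<open>[T]\<close>. If \<open>\<Sigma>\<close> and \<open>pair\<close> form a pullback, then these maps are invertible with inverse \<open>pair\<close>;
  conversely \<open>T = \<one>\<close> already shows that they are invertible.
\<close>

section \<open>Internal right adjoints from universal arrows\<close>

text \<open>Everything is checked at one stage \<open>X\<close> at a time: a square of presheaves is
  a pullback iff its components are, and at a fixed stage an internal category is an ordinary one,
  with hom-sets \<open>ihom\<close>. For an adjunction this works as soon as the object part of the
  right adjoint and the counit are natural in \<open>X\<close>: restricting a transpose solves the
  restricted universal problem, so by uniqueness it is the transpose there, and the morphism part
  and the unit inherit naturality. The obstacle is that a map of fibres at stage \<open>X\<close> is
  a function of pairs \<open>(s, t)\<close> with \<open>s\<close> an arrow into \<open>X\<close>, so
  it sees all later stages at once, while the pullback speaks of terms at one stage. From the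
  pullback to the adjoint, pairs are therefore decomposed at each \<open>s\<close>, over the
  restriction of \<open>x = (A, B)\<close> along \<open>s\<close>. Conversely, a map out of the unit
  type is its value at the identity arrow and \<open>star\<close>; the equations are read off there
  and naturality carries them to every \<open>s\<close>.\<close>

definition ihom :: "('o, 'm, 'x, 'y) icat \<Rightarrow> 'o \<Rightarrow> 'x \<Rightarrow> 'x \<Rightarrow> 'y set" where
  "ihom A X x y = {f \<in> el (imor A) X. isrc A X f = x \<and> itgt A X f = y}"

lemma ihom_iff: "f \<in> ihom A X x y \<longleftrightarrow> f \<in> el (imor A) X \<and> isrc A X f = x \<and> itgt A X f = y"
  by (simp add: ihom_def)

lemma ihom_ob:
  assumes "internal_category C A" "X \<in> Obj C" "f \<in> ihom A X x y"
  shows "x \<in> el (iob A) X" "y \<in> el (iob A) X"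
  using assms by (auto simp: internal_category_def ihom_iff nat_trans_def)

lemma ihom_id:
  assumes "internal_category C A" "X \<in> Obj C" "x \<in> el (iob A) X"
  shows "iid A X x \<in> ihom A X x x"
  using assms by (auto simp: internal_category_def ihom_iff nat_trans_def)

lemma ihom_comp:
  assumes "internal_category C A" "X \<in> Obj C" "g \<in> ihom A X y z" "f \<in> ihom A X x y"
  shows "icomp A X (g, f) \<in> ihom A X x z"
proof -
  have "(g, f) \<in> el (composable A) X" using assms by (simp add: composable_def ihom_iff)
  then show ?thesis
    using assms unfolding internal_category_def ihom_iff nat_trans_def by fast
qed

lemma ihom_comp_id:
  assumes "internal_category C A" "X \<in> Obj C" "f \<in> ihom A X x y"
  shows "icomp A X (f, iid A X x) = f" "icomp A X (iid A X y, f) = f"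
  using assms by (auto simp: internal_category_def ihom_iff)

lemma ihom_assoc:
  assumes "internal_category C A" "X \<in> Obj C"
    "h \<in> ihom A X z w" "g \<in> ihom A X y z" "f \<in> ihom A X x y"
  shows "icomp A X (icomp A X (h, g), f) = icomp A X (h, icomp A X (g, f))"
proof -
  have "(h, g) \<in> el (composable A) X" "(g, f) \<in> el (composable A) X"
    using assms by (auto simp: composable_def ihom_iff)
  then show ?thesis using assms(1,2) unfolding internal_category_def by blast
qed

lemma ihom_res:
  assumes "internal_category C A" "r \<in> Arr C" "f \<in> ihom A (Cod C r) x y"
  shows "res (imor A) r f \<in> ihom A (Dom C r) (res (iob A) r x) (res (iob A) r y)"
  using assms by (auto simp: internal_category_def ihom_iff nat_trans_def presheaf_def)

lemma ihom_comp_res: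
  assumes "internal_category C A" "r \<in> Arr C" "g \<in> ihom A (Cod C r) y z" "f \<in> ihom A (Cod C r) x y"
  shows "res (imor A) r (icomp A (Cod C r) (g, f)) =
    icomp A (Dom C r) (res (imor A) r g, res (imor A) r f)"
proof -
  have "(g, f) \<in> el (composable A) (Cod C r)" using assms by (simp add: composable_def ihom_iff)
  then have "icomp A (Dom C r) (res (composable A) r (g, f)) =
      res (imor A) r (icomp A (Cod C r) (g, f))"
    using assms unfolding internal_category_def nat_trans_def by blast
  then show ?thesis by (simp add: composable_def)
qed

lemma ihom_id_res:
  assumes "internal_category C A" "r \<in> Arr C" "x \<in> el (iob A) (Cod C r)"
  shows "res (imor A) r (iid A (Cod C r) x) = iid A (Dom C r) (res (iob A) r x)"
  using assms by (auto simp: internal_category_def nat_trans_def)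

lemma internal_functor_ihom:
  assumes "internal_functor C A B F" "X \<in> Obj C" "f \<in> ihom A X x y"
  shows "fmor F X f \<in> ihom B X (fob F X x) (fob F X y)"
  using assms by (auto simp: internal_functor_def ihom_iff nat_trans_def)

lemma internal_functor_comp:
  assumes "internal_functor C A B F" "X \<in> Obj C" "g \<in> ihom A X y z" "f \<in> ihom A X x y"
  shows "fmor F X (icomp A X (g, f)) = icomp B X (fmor F X g, fmor F X f)"
proof -
  have "(g, f) \<in> el (composable A) X" using assms by (simp add: composable_def ihom_iff)
  then show ?thesis using assms unfolding internal_functor_def by fast
qed

lemma internal_functor_sel:
  assumes "internal_functor C A B F"
  shows "nat_trans C (iob A) (iob B) (fob F)" "nat_trans C (imor A) (imor B) (fmor F)"
    "X \<in> Obj C \<Longrightarrow> x \<in> el (iob A) X \<Longrightarrow> fmor F X (iid A X x) = iid B X (fob F X x)"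
  using assms by (auto simp: internal_functor_def)

section \<open>Adjunctions and universal arrows\<close>

definition universal_arrows ::
  "('o, 'm) cat \<Rightarrow> ('o, 'm, 'x, 'y) icat \<Rightarrow> ('o, 'm, 'x2, 'y2) icat \<Rightarrow>
   ('o, 'x, 'y, 'x2, 'y2) ifun \<Rightarrow> ('o \<Rightarrow> 'x2 \<Rightarrow> 'x) \<Rightarrow> ('o \<Rightarrow> 'x2 \<Rightarrow> 'y2) \<Rightarrow> bool" where
  "universal_arrows C A B F G \<epsilon> \<longleftrightarrow>
     nat_trans C (iob B) (iob A) G \<and> nat_trans C (iob B) (imor B) \<epsilon> \<and>
     (\<forall>X\<in>Obj C. \<forall>y\<in>el (iob B) X.
        \<epsilon> X y \<in> ihom B X (fob F X (G X y)) y \<and>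
        (\<forall>x\<in>el (iob A) X. \<forall>h\<in>ihom B X (fob F X x) y.
           \<exists>!k. k \<in> ihom A X x (G X y) \<and> icomp B X (\<epsilon> X y, fmor F X k) = h))"

text \<open>The transpose of \<open>h\<close> is \<open>G h\<close> after the unit. It solves the
  problem by naturality of the counit and the first triangle identity; it is the only solution by
  naturality of the unit and the second.\<close>

lemma universal_arrows_of_adjunction:
  assumes A: "internal_category C A" and B: "internal_category C B"
    and adj: "internal_adjunction C A B F G \<eta> \<epsilon>"
  shows "universal_arrows C A B F (fob G) \<epsilon>"
proof -
  have F: "internal_functor C A B F" and G: "internal_functor C B A G"
    and \<eta>: "internal_nat_trans C A A ifun_id (ifun_comp G F) \<eta>"
    and \<epsilon>: "internal_nat_trans C B B (ifun_comp F G) ifun_id \<epsilon>"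
    and tri1: "\<And>X x. X \<in> Obj C \<Longrightarrow> x \<in> el (iob A) X \<Longrightarrow>
      icomp B X (\<epsilon> X (fob F X x), fmor F X (\<eta> X x)) = iid B X (fob F X x)"
    and tri2: "\<And>X y. X \<in> Obj C \<Longrightarrow> y \<in> el (iob B) X \<Longrightarrow>
      icomp A X (fmor G X (\<epsilon> X y), \<eta> X (fob G X y)) = iid A X (fob G X y)"
    using adj unfolding internal_adjunction_def by blast+
  have \<eta>_hom: "\<eta> X x \<in> ihom A X x (fob G X (fob F X x))" if "X \<in> Obj C" "x \<in> el (iob A) X" for X x
    using \<eta> that by (auto simp: internal_nat_trans_def nat_trans_def ihom_iff ifun_id_def
      ifun_comp_def nat_id_def nat_comp_def)
  have \<epsilon>_hom: "\<epsilon> X y \<in> ihom B X (fob F X (fob G X y)) y" if "X \<in> Obj C" "y \<in> el (iob B) X" for X y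
    using \<epsilon> that by (auto simp: internal_nat_trans_def nat_trans_def ihom_iff ifun_id_def
      ifun_comp_def nat_id_def nat_comp_def)
  have \<eta>_nat: "icomp A X (\<eta> X y, k) = icomp A X (fmor G X (fmor F X k), \<eta> X x)"
    if "X \<in> Obj C" "k \<in> ihom A X x y" for X x y k
    using \<eta> that by (auto simp: internal_nat_trans_def ihom_iff ifun_id_def
      ifun_comp_def nat_id_def nat_comp_def)
  have \<epsilon>_nat: "icomp B X (\<epsilon> X y, fmor F X (fmor G X h)) = icomp B X (h, \<epsilon> X x)"
    if "X \<in> Obj C" "h \<in> ihom B X x y" for X x y h
    using \<epsilon> that by (auto simp: internal_nat_trans_def ihom_iff ifun_id_def
      ifun_comp_def nat_id_def nat_comp_def)
  have uni: "\<exists>!k. k \<in> ihom A X x (fob G X y) \<and> icomp B X (\<epsilon> X y, fmor F X k) = h"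
    if X: "X \<in> Obj C" and y: "y \<in> el (iob B) X" and x: "x \<in> el (iob A) X"
      and h: "h \<in> ihom B X (fob F X x) y" for X x y h
  proof (rule ex1I[of _ "icomp A X (fmor G X h, \<eta> X x)"])
    have Fx: "fob F X x \<in> el (iob B) X" using ihom_ob[OF B X h] by blast
    have Gh: "fmor G X h \<in> ihom A X (fob G X (fob F X x)) (fob G X y)"
      by (rule internal_functor_ihom[OF G X h])
    have FG: "fmor F X (fmor G X h) \<in> ihom B X (fob F X (fob G X (fob F X x))) (fob F X (fob G X y))"
      by (rule internal_functor_ihom[OF F X Gh])
    have F\<eta>: "fmor F X (\<eta> X x) \<in> ihom B X (fob F X x) (fob F X (fob G X (fob F X x)))"
      by (rule internal_functor_ihom[OF F X \<eta>_hom[OF X x]])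
    have "icomp B X (\<epsilon> X y, fmor F X (icomp A X (fmor G X h, \<eta> X x))) =
        icomp B X (icomp B X (\<epsilon> X y, fmor F X (fmor G X h)), fmor F X (\<eta> X x))"
      by (simp only: internal_functor_comp[OF F X Gh \<eta>_hom[OF X x]]
        ihom_assoc[OF B X \<epsilon>_hom[OF X y] FG F\<eta>])
    also have "\<dots> = icomp B X (h, icomp B X (\<epsilon> X (fob F X x), fmor F X (\<eta> X x)))"
      by (simp only: \<epsilon>_nat[OF X h] ihom_assoc[OF B X h \<epsilon>_hom[OF X Fx] F\<eta>])
    also have "\<dots> = h" by (simp only: tri1[OF X x] ihom_comp_id[OF B X h])
    finally show "icomp A X (fmor G X h, \<eta> X x) \<in> ihom A X x (fob G X y) \<and>
        icomp B X (\<epsilon> X y, fmor F X (icomp A X (fmor G X h, \<eta> X x))) = h"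
      using ihom_comp[OF A X Gh \<eta>_hom[OF X x]] by blast
  next
    fix k assume k: "k \<in> ihom A X x (fob G X y) \<and> icomp B X (\<epsilon> X y, fmor F X k) = h"
    then have kh: "k \<in> ihom A X x (fob G X y)" by blast
    have Fk: "fmor F X k \<in> ihom B X (fob F X x) (fob F X (fob G X y))"
      by (rule internal_functor_ihom[OF F X kh])
    have Gy: "fob G X y \<in> el (iob A) X" using ihom_ob[OF A X kh] by blast
    have G\<epsilon>: "fmor G X (\<epsilon> X y) \<in> ihom A X (fob G X (fob F X (fob G X y))) (fob G X y)"
      by (rule internal_functor_ihom[OF G X \<epsilon>_hom[OF X y]])
    have GFk: "fmor G X (fmor F X k) \<in> ihom A X (fob G X (fob F X x)) (fob G X (fob F X (fob G X y)))"
      by (rule internal_functor_ihom[OF G X Fk])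
    have "icomp A X (fmor G X h, \<eta> X x) =
        icomp A X (icomp A X (fmor G X (\<epsilon> X y), fmor G X (fmor F X k)), \<eta> X x)"
      using k internal_functor_comp[OF G X \<epsilon>_hom[OF X y] Fk] by simp
    also have "\<dots> = icomp A X (fmor G X (\<epsilon> X y), icomp A X (\<eta> X (fob G X y), k))"
      by (simp only: ihom_assoc[OF A X G\<epsilon> GFk \<eta>_hom[OF X x]] \<eta>_nat[OF X kh])
    also have "\<dots> = icomp A X (icomp A X (fmor G X (\<epsilon> X y), \<eta> X (fob G X y)), k)"
      by (simp only: ihom_assoc[OF A X G\<epsilon> \<eta>_hom[OF X Gy] kh])
    also have "\<dots> = k" by (simp only: tri2[OF X y] ihom_comp_id[OF A X kh])
    finally show "k = icomp A X (fmor G X h, \<eta> X x)" by simp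
  qed
  show ?thesis
    unfolding universal_arrows_def
    using internal_functor_sel(1)[OF G] \<epsilon> \<epsilon>_hom uni
    unfolding internal_nat_trans_def by blast
qed

text \<open>The missing data are all transposes, and every required equation is between maps into
  some \<open>G X y\<close>, so it may be checked after applying \<open>F\<close> and composing with
  the counit.\<close>

lemma adjunction_of_universal_arrows:
  assumes C: "category C" and A: "internal_category C A" and B: "internal_category C B"
    and F: "internal_functor C A B F" and u: "universal_arrows C A B F G \<epsilon>"
  shows "has_internal_right_adjoint C A B F"
proof -
  have G_nat: "nat_trans C (iob B) (iob A) G" and \<epsilon>_psh: "nat_trans C (iob B) (imor B) \<epsilon>"
    using u by (auto simp: universal_arrows_def)
  have \<epsilon>: "\<epsilon> X y \<in> ihom B X (fob F X (G X y)) y" if "X \<in> Obj C" "y \<in> el (iob B) X" for X y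
    using u that by (auto simp: universal_arrows_def)
  \<comment> \<open>The transpose of \<open>h\<close>. The object \<open>x\<close> is an argument
    because the source of \<open>h\<close> determines only \<open>fob F X x\<close>.\<close>
  define tr where "tr = (\<lambda>X x y h. THE k. k \<in> ihom A X x (G X y) \<and> icomp B X (\<epsilon> X y, fmor F X k) = h)"
  have tr: "tr X x y h \<in> ihom A X x (G X y)" "icomp B X (\<epsilon> X y, fmor F X (tr X x y h)) = h"
    and tr_eq: "\<And>k. k \<in> ihom A X x (G X y) \<Longrightarrow> icomp B X (\<epsilon> X y, fmor F X k) = h \<Longrightarrow> k = tr X x y h"
    if X: "X \<in> Obj C" and x: "x \<in> el (iob A) X" and h: "h \<in> ihom B X (fob F X x) y" for X x y h
  proof -
    have e: "\<exists>!k. k \<in> ihom A X x (G X y) \<and> icomp B X (\<epsilon> X y, fmor F X k) = h"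
      using u X x h ihom_ob[OF B X h] by (auto simp: universal_arrows_def)
    show "tr X x y h \<in> ihom A X x (G X y)" "icomp B X (\<epsilon> X y, fmor F X (tr X x y h)) = h"
      using theI'[OF e] unfolding tr_def by blast+
    then show "\<And>k. k \<in> ihom A X x (G X y) \<Longrightarrow> icomp B X (\<epsilon> X y, fmor F X k) = h \<Longrightarrow> k = tr X x y h"
      using e by blast
  qed
  \<comment> \<open>The restriction of the transpose factors the restriction of \<open>h\<close>
    through the restricted counit, so uniqueness at stage \<open>Dom C r\<close> applies. This is
    the source of naturality for both \<open>Gm\<close> and \<open>\<eta>\<close>.\<close>
  have tr_res: "res (imor A) r (tr (Cod C r) x y h) =
      tr (Dom C r) (res (iob A) r x) (res (iob B) r y) (res (imor B) r h)"
    if r: "r \<in> Arr C" and x: "x \<in> el (iob A) (Cod C r)" and h: "h \<in> ihom B (Cod C r) (fob F (Cod C r) x) y"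
    for r x y h
  proof -
    have D: "Dom C r \<in> Obj C" "Cod C r \<in> Obj C" using r C by (auto simp: category_simps)
    have y: "y \<in> el (iob B) (Cod C r)" using ihom_ob[OF B D(2) h] by blast
    have x': "res (iob A) r x \<in> el (iob A) (Dom C r)"
      using A r x by (auto simp: internal_category_def presheaf_def)
    have y': "res (iob B) r y \<in> el (iob B) (Dom C r)"
      using B r y by (auto simp: internal_category_def presheaf_def)
    have Fx: "fob F (Dom C r) (res (iob A) r x) = res (iob B) r (fob F (Cod C r) x)"
      using nat_trans_res[OF internal_functor_sel(1)[OF F] r refl x] .
    have Gy: "G (Dom C r) (res (iob B) r y) = res (iob A) r (G (Cod C r) y)"
      using nat_trans_res[OF G_nat r refl y] .
    have ey: "\<epsilon> (Dom C r) (res (iob B) r y) = res (imor B) r (\<epsilon> (Cod C r) y)"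
      using nat_trans_res[OF \<epsilon>_psh r refl y] .
    note t = tr[OF D(2) x h]
    have h': "res (imor B) r h \<in> ihom B (Dom C r) (fob F (Dom C r) (res (iob A) r x)) (res (iob B) r y)"
      using ihom_res[OF B r h] by (simp only: Fx)
    show ?thesis
    proof (rule tr_eq[OF D(1) x' h'])
      show "res (imor A) r (tr (Cod C r) x y h) \<in>
          ihom A (Dom C r) (res (iob A) r x) (G (Dom C r) (res (iob B) r y))"
        using ihom_res[OF A r t(1)] by (simp only: Gy)
      have "fmor F (Dom C r) (res (imor A) r (tr (Cod C r) x y h)) =
          res (imor B) r (fmor F (Cod C r) (tr (Cod C r) x y h))"
        using nat_trans_res[OF internal_functor_sel(2)[OF F] r refl] t(1) by (auto simp: ihom_iff)
      then show "icomp B (Dom C r) (\<epsilon> (Dom C r) (res (iob B) r y),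
          fmor F (Dom C r) (res (imor A) r (tr (Cod C r) x y h))) = res (imor B) r h"
        using ihom_comp_res[OF B r \<epsilon>[OF D(2) y] internal_functor_ihom[OF F D(2) t(1)]] t(2)
        by (simp only: ey)
    qed
  qed
  have Fob: "fob F X x \<in> el (iob B) X" if "X \<in> Obj C" "x \<in> el (iob A) X" for X x
    using internal_functor_sel(1)[OF F] that by (rule nat_trans_el)
  have Gob: "G X y \<in> el (iob A) X" if "X \<in> Obj C" "y \<in> el (iob B) X" for X y
    using G_nat that by (rule nat_trans_el)
  \<comment> \<open>The action of the right adjoint on \<open>h : y -> z\<close> is the transpose of
    \<open>h\<close> after the counit at \<open>y\<close>, which is what naturality of the counit
    forces.\<close>
  define Gm where "Gm = (\<lambda>X h. tr X (G X (isrc B X h)) (itgt B X h) (icomp B X (h, \<epsilon> X (isrc B X h))))"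
  have Gm_eq: "Gm X h = tr X (G X y) z (icomp B X (h, \<epsilon> X y))" if "h \<in> ihom B X y z" for X h y z
    using that by (auto simp: Gm_def ihom_iff)
  \<comment> \<open>The unit is the transpose of the identity, so the first triangle identity holds
    by construction.\<close>
  define \<eta> where "\<eta> = (\<lambda>X x. tr X x (fob F X x) (iid B X (fob F X x)))"
  have hc: "icomp B X (h, \<epsilon> X y) \<in> ihom B X (fob F X (G X y)) z"
    if "X \<in> Obj C" "h \<in> ihom B X y z" for X h y z
    using ihom_comp[OF B that \<epsilon>[OF that(1)]] ihom_ob[OF B that] by blast
  have Gm: "Gm X h \<in> ihom A X (G X y) (G X z)"
    "icomp B X (\<epsilon> X z, fmor F X (Gm X h)) = icomp B X (h, \<epsilon> X y)"
    if "X \<in> Obj C" "h \<in> ihom B X y z" for X h y z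
    using tr[OF that(1) Gob[OF that(1) ihom_ob(1)[OF B that]] hc[OF that]] Gm_eq[OF that(2)] by simp_all
  have \<eta>: "\<eta> X x \<in> ihom A X x (G X (fob F X x))"
    "icomp B X (\<epsilon> X (fob F X x), fmor F X (\<eta> X x)) = iid B X (fob F X x)"
    if "X \<in> Obj C" "x \<in> el (iob A) X" for X x
    using tr[OF that ihom_id[OF B that(1) Fob[OF that]]] by (simp_all add: \<eta>_def)
  \<comment> \<open>Both maps are transposes of the same morphism.\<close>
  have cancel: "k = k'" if X: "X \<in> Obj C" and k: "k \<in> ihom A X x (G X y)" and k': "k' \<in> ihom A X x (G X y)"
    and y: "y \<in> el (iob B) X"
    and eq: "icomp B X (\<epsilon> X y, fmor F X k) = icomp B X (\<epsilon> X y, fmor F X k')" for X x y k k'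
  proof -
    have h: "icomp B X (\<epsilon> X y, fmor F X k') \<in> ihom B X (fob F X x) y"
      by (rule ihom_comp[OF B X \<epsilon>[OF X y] internal_functor_ihom[OF F X k']])
    show ?thesis using tr_eq[OF X ihom_ob(1)[OF A X k] h k eq] tr_eq[OF X ihom_ob(1)[OF A X k] h k' refl]
      by simp
  qed
  have shift: "icomp B X (\<epsilon> X y, fmor F X (icomp A X (k, l))) =
      icomp B X (icomp B X (\<epsilon> X y, fmor F X k), fmor F X l)"
    if X: "X \<in> Obj C" and y: "y \<in> el (iob B) X" and k: "k \<in> ihom A X x (G X y)" and l: "l \<in> ihom A X w x"
    for X y k l x w
    using internal_functor_comp[OF F X k l]
      ihom_assoc[OF B X \<epsilon>[OF X y] internal_functor_ihom[OF F X k] internal_functor_ihom[OF F X l]]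
    by simp
  have mor: "h \<in> ihom B X (isrc B X h) (itgt B X h)" if "h \<in> el (imor B) X" for h X
    using that by (simp add: ihom_iff)
  have morA: "h \<in> ihom A X (isrc A X h) (itgt A X h)" if "h \<in> el (imor A) X" for h X
    using that by (simp add: ihom_iff)
  let ?G = "\<lparr>fob = G, fmor = Gm\<rparr>"
  have "internal_functor C B A ?G"
  proof -
    have "Gm (Dom C r) (res (imor B) r h) = res (imor A) r (Gm (Cod C r) h)"
      if r: "r \<in> Arr C" and h: "h \<in> el (imor B) (Cod C r)" for r h
    proof -
      have D: "Cod C r \<in> Obj C" using r C by (auto simp: category_simps)
      note hh = mor[OF h]
      note y = ihom_ob(1)[OF B D hh]
      show ?thesis
        unfolding Gm_eq[OF hh] Gm_eq[OF ihom_res[OF B r hh]]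
        by (simp only: tr_res[OF r Gob[OF D y] hc[OF D hh]] ihom_comp_res[OF B r hh \<epsilon>[OF D y]]
          nat_trans_res[OF G_nat r refl y] nat_trans_res[OF \<epsilon>_psh r refl y])
    qed
    then have "nat_trans C (imor B) (imor A) Gm"
      using Gm[OF _ mor] by (auto simp: nat_trans_def ihom_iff)
    moreover have "Gm X (iid B X y) = iid A X (G X y)" if X: "X \<in> Obj C" and y: "y \<in> el (iob B) X" for X y
    proof (rule cancel[OF X Gm(1)[OF X ihom_id[OF B X y]] ihom_id[OF A X Gob[OF X y]] y])
      show "icomp B X (\<epsilon> X y, fmor F X (Gm X (iid B X y))) = icomp B X (\<epsilon> X y, fmor F X (iid A X (G X y)))"
        by (simp only: Gm(2)[OF X ihom_id[OF B X y]] internal_functor_sel(3)[OF F X Gob[OF X y]]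
          ihom_comp_id[OF B X \<epsilon>[OF X y]])
    qed
    moreover have "Gm X (icomp B X (g, f)) = icomp A X (Gm X g, Gm X f)"
      if X: "X \<in> Obj C" and gf: "(g, f) \<in> el (composable B) X" for X g f
    proof -
      obtain x y z where f: "f \<in> ihom B X x y" and g: "g \<in> ihom B X y z"
        using gf by (auto simp: composable_def ihom_iff)
      note x = ihom_ob(1)[OF B X f] and y = ihom_ob(1)[OF B X g] and z = ihom_ob(2)[OF B X g]
      note gf' = ihom_comp[OF B X g f]
      show ?thesis
      proof (rule cancel[OF X Gm(1)[OF X gf'] ihom_comp[OF A X Gm(1)[OF X g] Gm(1)[OF X f]] z])
        have "icomp B X (\<epsilon> X z, fmor F X (icomp A X (Gm X g, Gm X f))) =
            icomp B X (icomp B X (g, \<epsilon> X y), fmor F X (Gm X f))"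
          by (simp only: shift[OF X z Gm(1)[OF X g] Gm(1)[OF X f]] Gm(2)[OF X g])
        also have "\<dots> = icomp B X (icomp B X (g, f), \<epsilon> X x)"
          by (simp only: ihom_assoc[OF B X g \<epsilon>[OF X y] internal_functor_ihom[OF F X Gm(1)[OF X f]]]
            Gm(2)[OF X f] ihom_assoc[OF B X g f \<epsilon>[OF X x]])
        finally show "icomp B X (\<epsilon> X z, fmor F X (Gm X (icomp B X (g, f)))) =
            icomp B X (\<epsilon> X z, fmor F X (icomp A X (Gm X g, Gm X f)))"
          by (simp only: Gm(2)[OF X gf'])
      qed
    qed
    ultimately show ?thesis
      unfolding internal_functor_def using G_nat Gm(1)[OF _ mor] by (auto simp: ihom_iff)
  qed
  moreover have "internal_nat_trans C A A ifun_id (ifun_comp ?G F) \<eta>"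
  proof -
    have "\<eta> (Dom C r) (res (iob A) r x) = res (imor A) r (\<eta> (Cod C r) x)"
      if r: "r \<in> Arr C" and x: "x \<in> el (iob A) (Cod C r)" for r x
    proof -
      have D: "Cod C r \<in> Obj C" using r C by (auto simp: category_simps)
      show ?thesis
        unfolding \<eta>_def
        by (simp only: tr_res[OF r x ihom_id[OF B D Fob[OF D x]]] ihom_id_res[OF B r Fob[OF D x]]
          nat_trans_res[OF internal_functor_sel(1)[OF F] r refl x])
    qed
    then have "nat_trans C (iob A) (imor A) \<eta>" using \<eta> by (auto simp: nat_trans_def ihom_iff)
    moreover have "icomp A X (\<eta> X y, k) = icomp A X (Gm X (fmor F X k), \<eta> X x)"
      if X: "X \<in> Obj C" and k: "k \<in> ihom A X x y" for X k x y
    proof -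
      note x = ihom_ob(1)[OF A X k] and y = ihom_ob(2)[OF A X k]
      note Fk = internal_functor_ihom[OF F X k]
      note GFk = Gm(1)[OF X Fk]
      show ?thesis
      proof (rule cancel[OF X ihom_comp[OF A X \<eta>(1)[OF X y] k] ihom_comp[OF A X GFk \<eta>(1)[OF X x]] Fob[OF X y]])
        have "icomp B X (\<epsilon> X (fob F X y), fmor F X (icomp A X (\<eta> X y, k))) = fmor F X k"
          by (simp only: shift[OF X Fob[OF X y] \<eta>(1)[OF X y] k] \<eta>(2)[OF X y] ihom_comp_id[OF B X Fk])
        moreover have "icomp B X (\<epsilon> X (fob F X y), fmor F X (icomp A X (Gm X (fmor F X k), \<eta> X x))) = fmor F X k"
          by (simp only: shift[OF X Fob[OF X y] GFk \<eta>(1)[OF X x]] Gm(2)[OF X Fk] \<eta>(2)[OF X x]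
            ihom_assoc[OF B X Fk \<epsilon>[OF X Fob[OF X x]] internal_functor_ihom[OF F X \<eta>(1)[OF X x]]]
            ihom_comp_id[OF B X Fk])
        ultimately show "icomp B X (\<epsilon> X (fob F X y), fmor F X (icomp A X (\<eta> X y, k))) =
            icomp B X (\<epsilon> X (fob F X y), fmor F X (icomp A X (Gm X (fmor F X k), \<eta> X x)))" by simp
      qed
    qed
    ultimately show ?thesis
      unfolding internal_nat_trans_def using \<eta>(1) morA
      by (auto simp: ihom_iff ifun_id_def ifun_comp_def nat_id_def nat_comp_def)
  qed
  moreover have "internal_nat_trans C B B (ifun_comp F ?G) ifun_id \<epsilon>"
    unfolding internal_nat_trans_def using \<epsilon> \<epsilon>_psh Gm(2)[OF _ mor]
    by (auto simp: ihom_iff ifun_id_def ifun_comp_def nat_id_def nat_comp_def)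
  moreover have "icomp A X (Gm X (\<epsilon> X y), \<eta> X (G X y)) = iid A X (G X y)"
    if X: "X \<in> Obj C" and y: "y \<in> el (iob B) X" for X y
  proof -
    note e = \<epsilon>[OF X y] and Gy = Gob[OF X y]
    note Ge = Gm(1)[OF X e]
    show ?thesis
    proof (rule cancel[OF X ihom_comp[OF A X Ge \<eta>(1)[OF X Gy]] ihom_id[OF A X Gy] y])
      show "icomp B X (\<epsilon> X y, fmor F X (icomp A X (Gm X (\<epsilon> X y), \<eta> X (G X y)))) =
          icomp B X (\<epsilon> X y, fmor F X (iid A X (G X y)))"
        by (simp only: shift[OF X y Ge \<eta>(1)[OF X Gy]] Gm(2)[OF X e]
          ihom_assoc[OF B X e \<epsilon>[OF X Fob[OF X Gy]] internal_functor_ihom[OF F X \<eta>(1)[OF X Gy]]]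
          \<eta>(2)[OF X Gy] internal_functor_sel(3)[OF F X Gy])
    qed
  qed
  ultimately have "internal_adjunction C A B F ?G \<eta> \<epsilon>"
    unfolding internal_adjunction_def using F \<eta>(2) by simp
  then show ?thesis unfolding has_internal_right_adjoint_def by blast
qed

section \<open>Morphisms out of the image of the diagonal functor\<close>

locale unital_natural_model =
  fixes M :: "('o, 'm, 'v, 'u) nmodel"
    and one :: "'o \<Rightarrow> unit \<Rightarrow> 'u"
    and star :: "'o \<Rightarrow> unit \<Rightarrow> 'v"
  assumes model: "natural_model M"
    and unit: "unit_type M one star"
begin

abbreviation "C \<equiv> ctx M"
abbreviation "F \<equiv> ty M"
abbreviation "SumU \<equiv> sum_exp C F (base F)"
abbreviation "\<Delta> \<equiv> diag_functor M one"

section \<open>Stagewise facts about the model and its fibres\<close>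

lemma cat: "category C" and fam: "pfamily C F"
  using model by (auto simp: natural_model_def)

lemma psh: "presheaf C (total F)" "presheaf C (base F)" "presheaf C SumU" "presheaf C (pair_psh M)"
  and proj: "nat_trans C (total F) (base F) (proj F)"
  and pair_proj: "nat_trans C (pair_psh M) SumU pair_proj"
  using fam presheaf_sum_exp[OF cat fam] presheaf_pair_psh[OF model] by (auto simp: pfamily_def)

lemma arrows_toD:
  assumes "s \<in> arrows_to C X"
  shows "s \<in> Arr C" "Cod C s = X" "Dom C s \<in> Obj C" "X \<in> Obj C" "Comp C s (Idn C (Dom C s)) = s"
    "Comp C (Idn C X) s = s" "Idn C (Dom C s) \<in> arrows_to C (Dom C s)" "Idn C X \<in> arrows_to C X"
    "Dom C (Idn C X) = X"
  using assms cat by (auto simp: arrows_to_def category_simps)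

lemma Idn_arrows_to: "X \<in> Obj C \<Longrightarrow> Idn C X \<in> arrows_to C X \<and> Dom C (Idn C X) = X"
  using cat by (auto simp: arrows_to_def category_simps)

lemma fibre_iff: "v \<in> fibre C F A s \<longleftrightarrow> v \<in> el (total F) (Dom C s) \<and> proj F (Dom C s) v = res (base F) s A"
  by (simp add: fibre_def)

lemma fibre_Idn:
  assumes "X \<in> Obj C" "A \<in> el (base F) X"
  shows "v \<in> fibre C F A (Idn C X) \<longleftrightarrow> v \<in> el (total F) X \<and> proj F X v = A"
  using assms cat by (auto simp: fibre_iff category_simps presheaf_Idn[OF psh(2)])

lemma res_arrow:
  assumes "presheaf C P" "s \<in> arrows_to C X" "x \<in> el P X"
  shows "res P s x \<in> el P (Dom C s)"
  using assms presheaf_res[of C P s] by (auto simp: arrows_to_def)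

lemma nat_arrow:
  assumes "nat_trans C P Q t" "s \<in> arrows_to C X" "x \<in> el P X"
  shows "t (Dom C s) (res P s x) = res Q s (t X x)"
  using assms nat_trans_res[of C P Q t s] by (auto simp: arrows_to_def)

lemma res_arrow_Comp:
  assumes "presheaf C P" "s \<in> arrows_to C X" "r \<in> arrows_to C (Dom C s)" "x \<in> el P X"
  shows "res P (Comp C s r) x = res P r (res P s x)"
  using assms presheaf_Comp[of C P s r x] by (auto simp: arrows_to_def)

text \<open>Evaluated at the single element of the terminal presheaf, the pullback square says that
  \<open>star\<close> is the only term of the unit type at each stage; the restriction laws are
  naturality of \<open>one\<close> and \<open>star\<close>.\<close>

lemma one: "X \<in> Obj C \<Longrightarrow> one X () \<in> el (base F) X"
  and one_res: "s \<in> arrows_to C X \<Longrightarrow> res (base F) s (one X ()) = one (Dom C s) ()"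
  and star: "X \<in> Obj C \<Longrightarrow> star X () \<in> el (total F) X"
  and star_res: "s \<in> arrows_to C X \<Longrightarrow> res (total F) s (star X ()) = star (Dom C s) ()"
  and proj_star: "X \<in> Obj C \<Longrightarrow> proj F X (star X ()) = one X ()"
  and star_unique: "X \<in> Obj C \<Longrightarrow> v \<in> el (total F) X \<Longrightarrow> proj F X v = one X () \<Longrightarrow> v = star X ()"
proof -
  let ?T = "terminal_psh :: ('o, 'm, unit) psh"
  have T: "presheaf C ?T" by (auto simp: presheaf_def terminal_psh_def)
  note u = unit[unfolded unit_type_def is_pullback_iff_pointwise[OF cat T psh(1) T]]
  have nt: "nat_trans C ?T (total F) star" "nat_trans C ?T (base F) one"
    and comm: "\<forall>W\<in>Obj C. \<forall>z\<in>el ?T W. proj F W (star W z) = one W (nat_id W z)"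
    and ex1: "\<forall>W\<in>Obj C. \<forall>x\<in>el ?T W. \<forall>y\<in>el (total F) W. proj F W y = one W x \<longrightarrow>
      (\<exists>!z. z \<in> el ?T W \<and> star W z = y \<and> nat_id W z = x)"
    using u by blast+
  have el: "() \<in> el ?T Y" "res ?T r () = ()" for Y :: 'o and r :: 'm
    by (auto simp: terminal_psh_def)
  show "one X () \<in> el (base F) X" "star X () \<in> el (total F) X" "proj F X (star X ()) = one X ()"
    if X: "X \<in> Obj C"
    using nat_trans_el[OF nt(2) X el(1)] nat_trans_el[OF nt(1) X el(1)] bspec[OF bspec[OF comm X] el(1)]
    by (simp_all add: nat_id_def)
  show "res (base F) s (one X ()) = one (Dom C s) ()" "res (total F) s (star X ()) = star (Dom C s) ()"
    if s: "s \<in> arrows_to C X"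
    using nat_arrow[OF nt(1) s el(1)] nat_arrow[OF nt(2) s el(1)] by (simp_all add: el(2))
  show "v = star X ()" if "X \<in> Obj C" "v \<in> el (total F) X" "proj F X v = one X ()"
  proof -
    have "\<exists>!z. z \<in> el ?T X \<and> star X z = v \<and> nat_id X z = ()"
      using ex1 that el(1)[of X] by blast
    then show ?thesis by auto
  qed
qed

text \<open>Since \<open>one\<close> is stable under restriction, the fibre at \<open>s\<close>
  consists of the terms of the unit type at stage \<open>Dom C s\<close>.\<close>

lemma fibre_one:
  assumes s: "s \<in> arrows_to C X"
  shows "fibre C F (one X ()) s = {star (Dom C s) ()}"
proof -
  note Y = arrows_toD(3)[OF s]
  have "v \<in> fibre C F (one X ()) s \<longleftrightarrow> v = star (Dom C s) ()" for v
    unfolding fibre_iff one_res[OF s] using star_unique[OF Y] star[OF Y] proj_star[OF Y] by blast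
  then show ?thesis by blast
qed

text \<open>An element \<open>v\<close> of a type at stage \<open>X\<close>, regarded as a map out of the unit type.\<close>

definition point :: "'o \<Rightarrow> 'v \<Rightarrow> 'm \<times> 'v \<Rightarrow> 'v" where
  "point X v = (\<lambda>(s, u) \<in> (SIGMA s:arrows_to C X. fibre C F (one X ()) s). res (total F) s v)"

lemma point_app: "s \<in> arrows_to C X \<Longrightarrow> u \<in> fibre C F (one X ()) s \<Longrightarrow> point X v (s, u) = res (total F) s v"
  by (simp add: point_def)

text \<open>A left inverse of \<open>point\<close>: distinct terms give distinct maps out of the
  unit type.\<close>

lemma point_star:
  assumes "X \<in> Obj C" "v \<in> el (total F) X"
  shows "point X v (Idn C X, star X ()) = v"
  using assms Idn_arrows_to[of X] fibre_one[of "Idn C X" X] point_app[of "Idn C X" X "star X ()"]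
    presheaf_Idn[OF psh(1)] by simp

lemma point_nat:
  assumes v: "v \<in> el (total F) X" and s: "s \<in> arrows_to C X" and r: "r \<in> arrows_to C (Dom C s)"
    and u: "u \<in> fibre C F (one X ()) s"
  shows "point X v (Comp C s r, res (total F) r u) = res (total F) r (point X v (s, u))"
  using arrows_to_Comp[OF cat s r] fibre_Comp[OF cat fam s r one u] arrows_toD(4)[OF s] s u
    res_arrow_Comp[OF psh(1) s r v]
  by (simp add: point_app)

lemma point_el:
  assumes v: "v \<in> el (total F) X"
  shows "point X v \<in> exp_el C F X (one X ()) (proj F X v)"
proof -
  have "res (total F) s v \<in> fibre C F (proj F X v) s" if "s \<in> arrows_to C X" for s
    using res_arrow[OF psh(1) that v] nat_arrow[OF proj that v] by (simp add: fibre_iff)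
  moreover have "point X v (s, u) = undefined" if "\<not> (s \<in> arrows_to C X \<and> u \<in> fibre C F (one X ()) s)" for s u
    using that by (auto simp: point_def)
  ultimately show ?thesis
    unfolding exp_el_def pi_el_iff using point_nat[OF v] by (auto simp only: point_app)
qed

text \<open>A Yoneda argument: the only argument of \<open>f\<close> at \<open>s\<close> is the
  restriction of \<open>star X ()\<close> along \<open>s\<close>, so naturality determines
  \<open>f\<close> by its value at the identity. With \<open>point_star\<close>, terms of
  \<open>A\<close> correspond bijectively to maps out of the unit type.\<close>

lemma exp_el_one:
  assumes X: "X \<in> Obj C" and f: "f \<in> exp_el C F X (one X ()) A"
  shows "f = point X (f (Idn C X, star X ()))"
proof
  fix z :: "'m \<times> 'v"
  obtain s u where z: "z = (s, u)" by fastforce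
  show "f z = point X (f (Idn C X, star X ())) z"
  proof (cases "s \<in> arrows_to C X \<and> u \<in> fibre C F (one X ()) s")
    case True
    then have s: "s \<in> arrows_to C X" and u: "u = res (total F) s (star X ())"
      using fibre_one star_res by auto
    \<comment> \<open>Naturality of \<open>f\<close> is used for \<open>s\<close> written as the
      identity of \<open>X\<close> composed with \<open>s\<close>.\<close>
    have "f (s, u) = res (total F) s (f (Idn C X, star X ()))"
      using exp_el_nat[OF f, of "Idn C X" s "star X ()"] Idn_arrows_to[OF X] fibre_one[of "Idn C X" X]
        arrows_toD(6)[OF s] s u by simp
    then show ?thesis using True by (simp add: z point_app)
  next
    case False
    then show ?thesis using f unfolding exp_el_def pi_el_iff by (auto simp: z point_def)
  qed
qed

lemma point_res:
  assumes "r \<in> arrows_to C X" "v \<in> el (total F) X"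
  shows "pi_res C r (point X v) = point (Dom C r) (res (total F) r v)"
proof -
  have "point X v = point (Cod C r) v" using assms by (simp add: arrows_to_def)
  moreover have "pi_res C r (point (Cod C r) v) = point (Dom C r) (res (total F) r v)"
    using assms arrows_to_Comp[OF cat assms(1)] arrows_toD[OF assms(1)] fibre_res[OF cat fam _ one, of r] one_res[OF assms(1)]
      res_arrow_Comp[OF psh(1) assms(1) _ assms(2)]
    by (auto simp: point_def pi_res_def fun_eq_iff restrict_def)
  ultimately show ?thesis by simp
qed

section \<open>Maps into the dependent sum as morphisms of families\<close>

text \<open>Maps from the fibre over \<open>T\<close> to the dependent sum \<open>\<Sum>a:[A]. [B(a)]\<close>, where \<open>x = (A, B)\<close>.\<close>

definition sections :: "'o \<Rightarrow> 'u \<Rightarrow> 'u \<times> ('m \<times> 'v \<Rightarrow> 'u) \<Rightarrow> (('m \<times> 'v \<Rightarrow> 'v) \<times> ('m \<times> 'v \<Rightarrow> 'v)) set" where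
  "sections X T x = {(f, g). f \<in> exp_el C F X T (fst x) \<and>
     g \<in> pi_el C X (fibre C F T) (res (total F))
       (\<lambda>s t. {v \<in> el (total F) (Dom C s). proj F (Dom C s) v = snd x (s, f (s, t))}) (res (total F))}"

lemma sectionsD:
  assumes "(f, g) \<in> sections X T x"
  shows "f \<in> exp_el C F X T (fst x)"
    "s \<in> arrows_to C X \<Longrightarrow> t \<in> fibre C F T s \<Longrightarrow> g (s, t) \<in> el (total F) (Dom C s)"
    "s \<in> arrows_to C X \<Longrightarrow> t \<in> fibre C F T s \<Longrightarrow> proj F (Dom C s) (g (s, t)) = snd x (s, f (s, t))"
    "\<not> (s \<in> arrows_to C X \<and> t \<in> fibre C F T s) \<Longrightarrow> g (s, t) = undefined"
    "s \<in> arrows_to C X \<Longrightarrow> r \<in> arrows_to C (Dom C s) \<Longrightarrow> t \<in> fibre C F T s \<Longrightarrow>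
      g (Comp C s r, res (total F) r t) = res (total F) r (g (s, t))"
  using assms unfolding sections_def pi_el_iff mem_Collect_eq prod.case by blast+

text \<open>The morphism from \<open>\<Delta> T\<close> to \<open>x\<close> in \<open>Fam\<close> corresponding to a map into the dependent sum.\<close>

definition fam_mor_of :: "'o \<Rightarrow> 'u \<Rightarrow> 'u \<times> ('m \<times> 'v \<Rightarrow> 'u) \<Rightarrow> ('m \<times> 'v \<Rightarrow> 'v) \<Rightarrow> ('m \<times> 'v \<Rightarrow> 'v) \<Rightarrow>
    ('m, 'v, 'u, 'v, 'u) fam_mor" where
  "fam_mor_of X T x f g = (fob \<Delta> X T, x, f,
     \<lambda>(s, t) \<in> (SIGMA s:arrows_to C X. fibre C F T s). point (Dom C s) (g (s, t)))"

lemma type_fam_sel: "iob (type_fam M) = SumU" "iob (type_icat M) = base F"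
  by (simp_all add: type_fam_def fam_sel type_icat_def full_subcat_def)

lemma internal_categories: "internal_category C (type_icat M)" "internal_category C (type_fam M)"
  unfolding type_icat_def type_fam_def
  using internal_category_full_subcat[OF cat fam] internal_category_fam[OF cat fam fam] by auto

lemmas diag = internal_functor_diag_functor[OF model unit]

lemma fob_diag:
  assumes "X \<in> Obj C" "T \<in> el (base F) X"
  shows "fob \<Delta> X T \<in> el SumU X"
  using nat_trans_el[OF internal_functor_sel(1)[OF diag]] assms by (simp add: type_fam_sel)

lemma fob_diag_sel: "fst (fob \<Delta> X T) = T"
  "s \<in> arrows_to C X \<Longrightarrow> t \<in> fibre C F T s \<Longrightarrow> snd (fob \<Delta> X T) (s, t) = one (Dom C s) ()"
  by (simp_all add: diag_functor_def const_unit_def)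

lemma ihom_type_fam: "h \<in> ihom (type_fam M) X x y \<longleftrightarrow> (\<exists>\<alpha> b. h = (x, y, \<alpha>, b) \<and> (x, y, \<alpha>, b) \<in> fam_mor_el C F F X)"
  by (cases h) (auto simp: ihom_iff type_fam_def fam_sel)

lemma ihom_type_icat: "k \<in> ihom (type_icat M) X A B \<longleftrightarrow>
    A \<in> el (base F) X \<and> B \<in> el (base F) X \<and> (\<exists>\<phi>. k = (A, B, \<phi>) \<and> \<phi> \<in> exp_el C F X A B)"
  by (cases k) (auto simp: ihom_iff type_icat_def full_subcat_def)

text \<open>The unit type sits over every \<open>t\<close>, so a component over
  \<open>(s, t)\<close> must be a map from it to the type of \<open>g (s, t)\<close>, and
  \<open>point\<close> provides one. Naturality of these components is
  \<open>point_res\<close>.\<close>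

lemma fam_mor_of_ihom:
  assumes X: "X \<in> Obj C" and T: "T \<in> el (base F) X" and x: "x \<in> el SumU X"
    and fg: "(f, g) \<in> sections X T x"
  shows "fam_mor_of X T x f g \<in> ihom (type_fam M) X (fob \<Delta> X T) x"
proof -
  let ?b = "\<lambda>(s, t) \<in> (SIGMA s:arrows_to C X. fibre C F T s). point (Dom C s) (g (s, t))"
  note D = sectionsD[OF fg]
  have b: "?b (s, t) = point (Dom C s) (g (s, t))" if "s \<in> arrows_to C X" "t \<in> fibre C F T s" for s t
    using that by simp
  have "?b (s, t) \<in> exp_el C F (Dom C s) (one (Dom C s) ()) (snd x (s, f (s, t)))"
    if "s \<in> arrows_to C X" "t \<in> fibre C F T s" for s t
    using point_el[OF D(2)[OF that]] unfolding b[OF that] D(3)[OF that] .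
  moreover have "?b (Comp C s r, res (total F) r t) = pi_res C r (?b (s, t))"
    if s: "s \<in> arrows_to C X" and r: "r \<in> arrows_to C (Dom C s)" and t: "t \<in> fibre C F T s" for s r t
    using point_res[OF r D(2)[OF s t]] D(5)[OF s r t]
    by (simp only: b[OF s t] b[OF arrows_to_Comp(1)[OF cat s r] fibre_Comp[OF cat fam s r T t]]
      arrows_to_Comp(2)[OF cat s r])
  ultimately have "(fob \<Delta> X T, x, f, ?b) \<in> fam_mor_el C F F X"
    unfolding fam_mor_el_iff using fob_diag[OF X T] x D(1)
    by (simp add: fob_diag_sel)
  then show ?thesis by (simp add: ihom_type_fam fam_mor_of_def)
qed

text \<open>Every component of \<open>h\<close> is a map out of the unit type and hence, by
  \<open>exp_el_one\<close>, the point of a term.\<close>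

lemma fam_mor_of_surj:
  assumes X: "X \<in> Obj C" and T: "T \<in> el (base F) X"
    and h: "h \<in> ihom (type_fam M) X (fob \<Delta> X T) x"
  obtains f g where "(f, g) \<in> sections X T x" "h = fam_mor_of X T x f g"
proof -
  obtain f b where h_eq: "h = (fob \<Delta> X T, x, f, b)" and el: "(fob \<Delta> X T, x, f, b) \<in> fam_mor_el C F F X"
    using h unfolding ihom_type_fam by blast
  note e = el[unfolded fam_mor_el_iff fob_diag_sel(1)]
  have x: "x \<in> el SumU X" and f: "f \<in> exp_el C F X T (fst x)" using e by blast+
  have b: "b (s, t) \<in> exp_el C F (Dom C s) (one (Dom C s) ()) (snd x (s, f (s, t)))"
    if "s \<in> arrows_to C X" "t \<in> fibre C F T s" for s t
    using e that fob_diag_sel(2)[OF that] by metis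
  have b_nat: "b (Comp C s r, res (total F) r t) = pi_res C r (b (s, t))"
    if "s \<in> arrows_to C X" "r \<in> arrows_to C (Dom C s)" "t \<in> fibre C F T s" for s r t
    using e that by blast
  have b_undef: "b (s, t) = undefined" if "\<not> (s \<in> arrows_to C X \<and> t \<in> fibre C F T s)" for s t
    using e that by blast
  \<comment> \<open>The term is recovered by evaluating the component over \<open>(s, t)\<close>,
    which lives at stage \<open>Dom C s\<close>, at the identity of that stage and
    \<open>star\<close>.\<close>
  let ?g = "\<lambda>(s, t) \<in> (SIGMA s:arrows_to C X. fibre C F T s). b (s, t) (Idn C (Dom C s), star (Dom C s) ())"
  have g: "?g (s, t) = b (s, t) (Idn C (Dom C s), star (Dom C s) ())"
    if "s \<in> arrows_to C X" "t \<in> fibre C F T s" for s t using that by simp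
  have "?g (s, t) \<in> el (total F) (Dom C s) \<and> proj F (Dom C s) (?g (s, t)) = snd x (s, f (s, t))"
    if s: "s \<in> arrows_to C X" and t: "t \<in> fibre C F T s" for s t
  proof -
    have "snd x (s, f (s, t)) \<in> el (base F) (Dom C s)"
      using sum_exp_app[of "fst x" "snd x", OF _ s exp_el_app[OF f s t]] x by simp
    moreover have "b (s, t) (Idn C (Dom C s), star (Dom C s) ()) \<in>
        fibre C F (snd x (s, f (s, t))) (Idn C (Dom C s))"
      using exp_el_app[OF b[OF s t] arrows_toD(7)[OF s]] fibre_one[OF arrows_toD(7)[OF s]]
        Idn_arrows_to[OF arrows_toD(3)[OF s]] by simp
    ultimately show ?thesis
      unfolding g[OF s t] using fibre_Idn[OF arrows_toD(3)[OF s]] by blast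
  qed
  moreover have "?g (Comp C s r, res (total F) r t) = res (total F) r (?g (s, t))"
    if s: "s \<in> arrows_to C X" and r: "r \<in> arrows_to C (Dom C s)" and t: "t \<in> fibre C F T s" for s r t
  proof -
    note rr = arrows_toD[OF r] and ss = arrows_toD[OF s]
    have "?g (Comp C s r, res (total F) r t) = b (Comp C s r, res (total F) r t) (Idn C (Dom C r), star (Dom C r) ())"
      using g[OF arrows_to_Comp(1)[OF cat s r] fibre_Comp[OF cat fam s r T t]]
      by (simp only: arrows_to_Comp(2)[OF cat s r])
    \<comment> \<open>Restricting a component along \<open>r\<close> turns evaluation at the
      identity of \<open>Dom C r\<close> into evaluation at \<open>r\<close>, so naturality inside
      the single component \<open>b (s, t)\<close> finishes the argument.\<close>
    also have "\<dots> = b (s, t) (Comp C (Idn C (Dom C s)) r, res (total F) r (star (Dom C s) ()))"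
      using rr by (simp add: b_nat[OF s r t] pi_res_def star_res[OF r])
    also have "\<dots> = res (total F) r (b (s, t) (Idn C (Dom C s), star (Dom C s) ()))"
      using exp_el_nat[OF b[OF s t], of "Idn C (Dom C s)" r] Idn_arrows_to[OF ss(3)] fibre_one[of "Idn C (Dom C s)" "Dom C s"] r
      by simp
    finally show ?thesis by (simp only: g[OF s t])
  qed
  ultimately have "(f, ?g) \<in> sections X T x"
    using f unfolding sections_def pi_el_iff by simp
  moreover have "point (Dom C s) (?g (s, t)) = b (s, t)" if s: "s \<in> arrows_to C X" and t: "t \<in> fibre C F T s" for s t
    unfolding g[OF s t] by (rule exp_el_one[OF arrows_toD(3)[OF s] b[OF s t], symmetric])
  then have "(\<lambda>(s, t) \<in> (SIGMA s:arrows_to C X. fibre C F T s). point (Dom C s) (?g (s, t))) = b"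
    using b_undef by (auto simp: fun_eq_iff simp del: restrict_apply) (auto simp: restrict_def)
  then have "h = fam_mor_of X T x f ?g" by (simp only: h_eq fam_mor_of_def)
  ultimately show ?thesis using that by blast
qed

text \<open>Terms are compared at one argument at a time by evaluating their points at
  \<open>star\<close>. In this form the lemma also applies to pairs produced by
  \<open>pi_res\<close>, whose membership in \<open>sections\<close> is not established.\<close>

lemma fam_mor_of_eqD:
  assumes eq: "fam_mor_of X T x f g = fam_mor_of X T x f' g'"
  shows "f = f'"
    and "s \<in> arrows_to C X \<Longrightarrow> t \<in> fibre C F T s \<Longrightarrow> g (s, t) \<in> el (total F) (Dom C s) \<Longrightarrow>
      g' (s, t) \<in> el (total F) (Dom C s) \<Longrightarrow> g (s, t) = g' (s, t)"
proof -
  show "f = f'" using eq by (simp add: fam_mor_of_def)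
  assume st: "s \<in> arrows_to C X" "t \<in> fibre C F T s"
    and g: "g (s, t) \<in> el (total F) (Dom C s)" "g' (s, t) \<in> el (total F) (Dom C s)"
  have b: "restrict (\<lambda>(s, t). point (Dom C s) (g (s, t))) (SIGMA s:arrows_to C X. fibre C F T s) =
      restrict (\<lambda>(s, t). point (Dom C s) (g' (s, t))) (SIGMA s:arrows_to C X. fibre C F T s)"
    using eq by (simp add: fam_mor_of_def)
  have "point (Dom C s) (g (s, t)) = point (Dom C s) (g' (s, t))"
    using fun_cong[OF b, of "(s, t)"] st by simp
  then show "g (s, t) = g' (s, t)"
    using point_star[OF arrows_toD(3)[OF st(1)]] g by metis
qed

lemma fam_mor_of_inj:
  assumes fg: "(f, g) \<in> sections X T x" and fg': "(f', g') \<in> sections X T x"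
    and eq: "fam_mor_of X T x f g = fam_mor_of X T x f' g'"
  shows "f = f'" "g = g'"
proof -
  show "f = f'" by (rule fam_mor_of_eqD(1)[OF eq])
  have "g (s, t) = g' (s, t)" for s t
    using fam_mor_of_eqD(2)[OF eq] sectionsD(2,4)[OF fg] sectionsD(2,4)[OF fg'] by metis
  then show "g = g'" by auto
qed

lemma sections_comp:
  assumes T': "T' \<in> el (base F) X" and k: "k \<in> exp_el C F X T' T" and fg: "(f, g) \<in> sections X T x"
  shows "(exp_comp C F X T' f k, exp_comp C F X T' g k) \<in> sections X T' x"
proof -
  note D = sectionsD[OF fg]
  have c: "exp_comp C F X T' \<psi> k (s, t) = \<psi> (s, k (s, t))"
    if "s \<in> arrows_to C X" "t \<in> fibre C F T' s" for \<psi> :: "'m \<times> 'v \<Rightarrow> 'v" and s t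
    using that by (simp add: exp_comp_def)
  have "exp_comp C F X T' g k (Comp C s r, res (total F) r t) = res (total F) r (exp_comp C F X T' g k (s, t))"
    if s: "s \<in> arrows_to C X" and r: "r \<in> arrows_to C (Dom C s)" and t: "t \<in> fibre C F T' s" for s r t
    by (simp only: c[OF s t] c[OF arrows_to_Comp(1)[OF cat s r] fibre_Comp[OF cat fam s r T' t]]
      exp_el_nat[OF k s r t] D(5)[OF s r exp_el_app[OF k s t]])
  then show ?thesis
    using exp_comp_el[OF cat fam T' k D(1)] D(2,3) exp_el_app[OF k]
    unfolding sections_def pi_el_iff by (auto simp: c) (auto simp: exp_comp_def)
qed

text \<open>The components of \<open>fmor \<Delta> X (T', T, k)\<close> are identities of the unit
  type, so composing with it only reindexes along \<open>k\<close>.\<close>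

lemma fam_mor_of_comp:
  assumes k: "k \<in> exp_el C F X T' T" and fg: "(f, g) \<in> sections X T x"
  shows "icomp (type_fam M) X (fam_mor_of X T x f g, fmor \<Delta> X (T', T, k)) =
    fam_mor_of X T' x (exp_comp C F X T' f k) (exp_comp C F X T' g k)"
proof -
  have "exp_comp C F (Dom C s) (one (Dom C s) ()) (point (Dom C s) (g (s, k (s, t))))
      (exp_id C F (Dom C s) (one (Dom C s) ())) = point (Dom C s) (g (s, k (s, t)))"
    if s: "s \<in> arrows_to C X" and t: "t \<in> fibre C F T' s" for s t
    using exp_comp_id(1)[OF point_el[OF sectionsD(2)[OF fg s exp_el_app[OF k s t]]]] .
  then show ?thesis
    using exp_el_app[OF k]
    by (auto simp: fam_mor_of_def type_fam_def fam_def diag_functor_def const_unit_def exp_comp_def[of C F X]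
      fun_eq_iff restrict_def)
qed

text \<open>Used to pass between naturality of a counit in the stage and naturality of the two maps
  that represent it.\<close>

lemma fam_mor_of_res:
  assumes r: "r \<in> arrows_to C X" and T: "T \<in> el (base F) X" and fg: "(f, g) \<in> sections X T x"
  shows "res (imor (type_fam M)) r (fam_mor_of X T x f g) =
    fam_mor_of (Dom C r) (res (base F) r T) (res SumU r x) (pi_res C r f) (pi_res C r g)"
proof -
  have "fob \<Delta> (Dom C r) (res (base F) r T) = res SumU r (fob \<Delta> X T)"
    using nat_arrow[OF internal_functor_sel(1)[OF diag] r, of T] T by (simp add: type_fam_sel)
  moreover have "pi_res C r (\<lambda>(s, t) \<in> (SIGMA s:arrows_to C X. fibre C F T s). point (Dom C s) (g (s, t))) =
    (\<lambda>(s, t) \<in> (SIGMA s:arrows_to C (Dom C r). fibre C F (res (base F) r T) s).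
      point (Dom C s) (pi_res C r g (s, t)))"
    using arrows_to_Comp[OF cat r] arrows_toD(1,2)[OF r] fibre_res[OF cat fam, of r T] T
    by (auto simp: pi_res_def fun_eq_iff restrict_def)
  ultimately show ?thesis by (simp add: fam_mor_of_def type_fam_def fam_sel)
qed

section \<open>Dependent sums as values of the right adjoint\<close>

lemma SumU_res: "res SumU s x = (res (base F) s (fst x), pi_res C s (snd x))"
  by (cases x) (simp add: sum_exp_def)

lemma pair_psh_res: "res (pair_psh M) s (A, B, a, b) =
    (res (base F) s A, pi_res C s B, res (total F) s a, res (total F) s b)"
  by (simp add: pair_psh_def)

lemma SumU_fst: "x \<in> el SumU X \<Longrightarrow> fst x \<in> el (base F) X"
  by (auto simp: sum_exp_def)

lemma pair_psh_iff: "(fst x, snd x, a, b) \<in> el (pair_psh M) X \<longleftrightarrow>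
    x \<in> el SumU X \<and> a \<in> el (total F) X \<and> proj F X a = fst x \<and>
    b \<in> el (total F) X \<and> proj F X b = snd x (Idn C X, a)"
  by (simp add: pair_psh_def)

text \<open>The restriction of \<open>snd x\<close> along \<open>s\<close>, evaluated at the
  identity, is \<open>snd x\<close> evaluated at \<open>s\<close>. So pairs at stage
  \<open>Dom C s\<close> can be described by \<open>x\<close> itself, as in the definition of
  \<open>sections\<close>.\<close>

lemma pair_psh_arrow_iff:
  assumes s: "s \<in> arrows_to C X" and x: "x \<in> el SumU X"
  shows "(fst (res SumU s x), snd (res SumU s x), a, b) \<in> el (pair_psh M) (Dom C s) \<longleftrightarrow>
    a \<in> fibre C F (fst x) s \<and> b \<in> el (total F) (Dom C s) \<and> proj F (Dom C s) b = snd x (s, a)"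
proof -
  have "snd (res SumU s x) (Idn C (Dom C s), a) = snd x (s, a)"
    using arrows_toD[OF s] by (simp add: SumU_res pi_res_def)
  then show ?thesis
    unfolding pair_psh_iff using res_arrow[OF psh(3) s x] by (auto simp: fibre_iff SumU_res)
qed

text \<open>Outside the index set both functions are \<open>undefined\<close>, so equality has to be
  tested only inside it.\<close>

lemma exp_comp_eq_iff:
  assumes k: "k \<in> exp_el C F X T A" and f: "\<And>s t. \<not> (s \<in> arrows_to C X \<and> t \<in> fibre C F T s) \<Longrightarrow> f (s, t) = undefined"
  shows "exp_comp C F X T g k = f \<longleftrightarrow>
    (\<forall>s\<in>arrows_to C X. \<forall>t\<in>fibre C F T s. g (s, k (s, t)) = f (s, t))"
  using f by (auto simp: exp_comp_def fun_eq_iff restrict_def)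

lemma exp_el_undefined:
  "f \<in> exp_el C F X T A \<Longrightarrow> \<not> (s \<in> arrows_to C X \<and> t \<in> fibre C F T s) \<Longrightarrow> f (s, t) = undefined"
  unfolding exp_el_def pi_el_iff by blast

text \<open>The bridge used in both implications: if \<open>(p, q)\<close> represents a counit,
  factoring \<open>(f, g)\<close> through it by \<open>k\<close> amounts to equations between terms
  at each argument.\<close>

lemma fam_mor_of_comp_eq_iff:
  assumes T: "T \<in> el (base F) X" and pq: "(p, q) \<in> sections X A x" and fg: "(f, g) \<in> sections X T x"
    and k: "k \<in> exp_el C F X T A"
  shows "icomp (type_fam M) X (fam_mor_of X A x p q, fmor \<Delta> X (T, A, k)) = fam_mor_of X T x f g \<longleftrightarrow>
    (\<forall>s\<in>arrows_to C X. \<forall>t\<in>fibre C F T s. p (s, k (s, t)) = f (s, t) \<and> q (s, k (s, t)) = g (s, t))"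
proof -
  have "icomp (type_fam M) X (fam_mor_of X A x p q, fmor \<Delta> X (T, A, k)) = fam_mor_of X T x f g \<longleftrightarrow>
      exp_comp C F X T p k = f \<and> exp_comp C F X T q k = g"
    unfolding fam_mor_of_comp[OF k pq] using fam_mor_of_inj[OF sections_comp[OF T k pq] fg] by blast
  also have "\<dots> \<longleftrightarrow> (\<forall>s\<in>arrows_to C X. \<forall>t\<in>fibre C F T s. p (s, k (s, t)) = f (s, t) \<and> q (s, k (s, t)) = g (s, t))"
    using exp_comp_eq_iff[OF k, of f p] exp_el_undefined[OF sectionsD(1)[OF fg]]
      exp_comp_eq_iff[OF k, of g q] sectionsD(4)[OF fg] by blast
  finally show ?thesis .
qed

section \<open>From dependent sums to the right adjoint\<close>

lemma right_adjoint_if_dependent_sums: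
  assumes pb: "is_pullback C (pair_psh M) (total F) SumU (base F) pair pair_proj Sig (proj F)"
  shows "has_internal_right_adjoint C (type_icat M) (type_fam M) \<Delta>"
proof -
  note pw = pb[unfolded is_pullback_iff_pointwise[OF cat psh(4) psh(1) psh(3)]]
  have pair: "nat_trans C (pair_psh M) (total F) pair" and Sig: "nat_trans C SumU (base F) Sig"
    and comm: "\<And>W z. W \<in> Obj C \<Longrightarrow> z \<in> el (pair_psh M) W \<Longrightarrow> proj F W (pair W z) = Sig W (pair_proj W z)"
    and ex1: "\<And>W x y. W \<in> Obj C \<Longrightarrow> x \<in> el SumU W \<Longrightarrow> y \<in> el (total F) W \<Longrightarrow> proj F W y = Sig W x \<Longrightarrow>
      \<exists>!z. z \<in> el (pair_psh M) W \<and> pair W z = y \<and> pair_proj W z = x"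
    using pw by blast+
  \<comment> \<open>\<open>Q\<close> says that \<open>a\<close> and \<open>b\<close> form a pair
    over the restriction of \<open>x\<close> along \<open>s\<close>, \<open>c\<close> is the pairing
    map there, and \<open>d1\<close>, \<open>d2\<close> are the two components of its
    inverse.\<close>
  define Q where "Q = (\<lambda>x s a b. (fst (res SumU s x), snd (res SumU s x), a, b) \<in> el (pair_psh M) (Dom C s))"
  define c where "c = (\<lambda>x s a b. pair (Dom C s) (fst (res SumU s x), snd (res SumU s x), a, b))"
  define d1 where "d1 = (\<lambda>x s g. THE a. \<exists>b. Q x s a b \<and> c x s a b = g)"
  define d2 where "d2 = (\<lambda>x s g. THE b. \<exists>a. Q x s a b \<and> c x s a b = g)"
  have Q_iff: "Q x s a b \<longleftrightarrow> a \<in> fibre C F (fst x) s \<and> b \<in> el (total F) (Dom C s) \<and> proj F (Dom C s) b = snd x (s, a)"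
    if "s \<in> arrows_to C X" "x \<in> el SumU X" for X s x a b
    unfolding Q_def by (rule pair_psh_arrow_iff[OF that])
  have Sig_el: "Sig X x \<in> el (base F) X" if "X \<in> Obj C" "x \<in> el SumU X" for X x
    using nat_trans_el[OF Sig that] .
  have c_el: "c x s a b \<in> fibre C F (Sig X x) s"
    if s: "s \<in> arrows_to C X" and x: "x \<in> el SumU X" and q: "Q x s a b" for X s x a b
    using nat_trans_el[OF pair arrows_toD(3)[OF s]] comm[OF arrows_toD(3)[OF s]] q nat_arrow[OF Sig s x]
    unfolding Q_def c_def fibre_iff pair_proj_def by simp
  \<comment> \<open>The pullback property at stage \<open>Dom C s\<close>, applied to the
    restriction of \<open>x\<close> and the term \<open>g\<close> over it, gives exactly one pair
    that \<open>pair\<close> sends to \<open>g\<close>.\<close>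
  have d: "Q x s (d1 x s g) (d2 x s g)" "c x s (d1 x s g) (d2 x s g) = g"
    and d_eq: "\<And>a b. Q x s a b \<Longrightarrow> c x s a b = g \<Longrightarrow> d1 x s g = a \<and> d2 x s g = b"
    if "s \<in> arrows_to C X" "x \<in> el SumU X" "g \<in> fibre C F (Sig X x) s" for X s x g
  proof -
    note s = that(1) and x = that(2) and g = that(3)
    let ?x = "res SumU s x"
    have "\<exists>!z. z \<in> el (pair_psh M) (Dom C s) \<and> pair (Dom C s) z = g \<and> pair_proj (Dom C s) z = ?x"
      using g unfolding fibre_iff nat_arrow[OF Sig s x, symmetric]
      by (intro ex1 arrows_toD(3)[OF s] res_arrow[OF psh(3) s x]) blast+
    then obtain z where z: "z \<in> el (pair_psh M) (Dom C s)" "pair (Dom C s) z = g" "pair_proj (Dom C s) z = ?x"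
      and zu: "\<And>z'. z' \<in> el (pair_psh M) (Dom C s) \<Longrightarrow> pair (Dom C s) z' = g \<Longrightarrow> pair_proj (Dom C s) z' = ?x \<Longrightarrow> z' = z"
      by (elim ex1E) blast
    obtain a b where z_eq: "z = (fst ?x, snd ?x, a, b)"
      using z(3) by (cases z) (simp add: pair_proj_def prod_eq_iff)
    have ab: "Q x s a b" "c x s a b = g"
      using z(1,2) unfolding z_eq Q_def c_def by blast+
    have u: "a' = a \<and> b' = b" if "Q x s a' b'" "c x s a' b' = g" for a' b'
      using zu[of "(fst ?x, snd ?x, a', b')"] that unfolding z_eq Q_def c_def pair_proj_def by simp
    have dd: "d1 x s g = a" "d2 x s g = b"
      unfolding d1_def d2_def using ab u by (blast intro: the_equality)+
    show "Q x s (d1 x s g) (d2 x s g)" "c x s (d1 x s g) (d2 x s g) = g"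
      unfolding dd using ab by blast+
    show "d1 x s g = a' \<and> d2 x s g = b'" if "Q x s a' b'" "c x s a' b' = g" for a' b'
      unfolding dd using u[OF that] by blast
  qed
  have c_nat: "Q x (Comp C s r) (res (total F) r a) (res (total F) r b)"
    "c x (Comp C s r) (res (total F) r a) (res (total F) r b) = res (total F) r (c x s a b)"
    if s: "s \<in> arrows_to C X" and r: "r \<in> arrows_to C (Dom C s)" and x: "x \<in> el SumU X" and q: "Q x s a b"
    for X s r x a b
  proof -
    have e: "(fst (res SumU (Comp C s r) x), snd (res SumU (Comp C s r) x), res (total F) r a, res (total F) r b) =
        res (pair_psh M) r (fst (res SumU s x), snd (res SumU s x), a, b)"
      unfolding res_arrow_Comp[OF psh(3) s r x] by (simp add: pair_psh_res SumU_res)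
    show "Q x (Comp C s r) (res (total F) r a) (res (total F) r b)"
      "c x (Comp C s r) (res (total F) r a) (res (total F) r b) = res (total F) r (c x s a b)"
      using res_arrow[OF psh(4) r] nat_arrow[OF pair r] q
      unfolding Q_def c_def e arrows_to_Comp(2)[OF cat s r] by blast+
  qed
  \<comment> \<open>By \<open>c_nat\<close> the restricted components form a pair that is sent to
    the restricted \<open>g\<close>, and such a pair is unique.\<close>
  have d_nat: "d1 x (Comp C s r) (res (total F) r g) = res (total F) r (d1 x s g)"
    "d2 x (Comp C s r) (res (total F) r g) = res (total F) r (d2 x s g)"
    if s: "s \<in> arrows_to C X" and r: "r \<in> arrows_to C (Dom C s)" and x: "x \<in> el SumU X"
      and g: "g \<in> fibre C F (Sig X x) s" for X s r x g
    using d_eq[OF arrows_to_Comp(1)[OF cat s r] x fibre_Comp[OF cat fam s r Sig_el[OF arrows_toD(4)[OF s] x] g]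
      c_nat(1)[OF s r x d(1)[OF s x g]]] c_nat(2)[OF s r x d(1)[OF s x g]]
    unfolding d(2)[OF s x g] by blast+
  \<comment> \<open>Restricting \<open>x\<close> along \<open>r\<close> and then along
    \<open>s\<close> is restricting it along their composite, and the decomposition depends on
    \<open>x\<close> only through that restriction.\<close>
  have d_res: "d1 (res SumU r x) s g = d1 x (Comp C r s) g" "d2 (res SumU r x) s g = d2 x (Comp C r s) g"
    if r: "r \<in> arrows_to C X" and s: "s \<in> arrows_to C (Dom C r)" and x: "x \<in> el SumU X" for X r s x g
    unfolding d1_def d2_def Q_def c_def res_arrow_Comp[OF psh(3) r s x] arrows_to_Comp(2)[OF cat r s] by simp_all
  \<comment> \<open>The first and second projection out of \<open>Sig X x\<close>, made extensional;
    together they represent the counit at \<open>x\<close>.\<close>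
  define p1 where "p1 = (\<lambda>X x. \<lambda>(s, g) \<in> (SIGMA s:arrows_to C X. fibre C F (Sig X x) s). d1 x s g)"
  define p2 where "p2 = (\<lambda>X x. \<lambda>(s, g) \<in> (SIGMA s:arrows_to C X. fibre C F (Sig X x) s). d2 x s g)"
  have p: "p1 X x (s, g) = d1 x s g" "p2 X x (s, g) = d2 x s g"
    if "s \<in> arrows_to C X" "g \<in> fibre C F (Sig X x) s" for X x s g
    using that by (simp_all add: p1_def p2_def)
  have p_undef: "p1 X x (s, g) = undefined" "p2 X x (s, g) = undefined"
    if "\<not> (s \<in> arrows_to C X \<and> g \<in> fibre C F (Sig X x) s)" for X x s g
    using that unfolding p1_def p2_def restrict_def by auto
  have sec: "(p1 X x, p2 X x) \<in> sections X (Sig X x) x" if X: "X \<in> Obj C" and x: "x \<in> el SumU X" for X x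
  proof -
    have "p1 X x (Comp C s r, res (total F) r g) = res (total F) r (p1 X x (s, g))"
      "p2 X x (Comp C s r, res (total F) r g) = res (total F) r (p2 X x (s, g))"
      if s: "s \<in> arrows_to C X" and r: "r \<in> arrows_to C (Dom C s)" and g: "g \<in> fibre C F (Sig X x) s" for s r g
      by (simp_all only: p[OF s g] p[OF arrows_to_Comp(1)[OF cat s r] fibre_Comp[OF cat fam s r Sig_el[OF X x] g]]
        d_nat[OF s r x g])
    moreover have "p1 X x (s, g) \<in> fibre C F (fst x) s"
      "p2 X x (s, g) \<in> {v \<in> el (total F) (Dom C s). proj F (Dom C s) v = snd x (s, p1 X x (s, g))}"
      if s: "s \<in> arrows_to C X" and g: "g \<in> fibre C F (Sig X x) s" for s g
      using d(1)[OF s x g] unfolding Q_iff[OF s x] p[OF s g] by blast+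
    ultimately show ?thesis
      unfolding sections_def exp_el_def pi_el_iff mem_Collect_eq prod.case using p_undef by blast
  qed
  have p_res: "pi_res C r (p1 X x) = p1 (Dom C r) (res SumU r x)" "pi_res C r (p2 X x) = p2 (Dom C r) (res SumU r x)"
    if r: "r \<in> arrows_to C X" and x: "x \<in> el SumU X" for X r x
  proof -
    have fib: "fibre C F (Sig (Dom C r) (res SumU r x)) s = fibre C F (Sig X x) (Comp C r s)"
      if "s \<in> arrows_to C (Dom C r)" for s
      using fibre_res[OF cat fam, of r "Sig X x" s] arrows_toD[OF r] Sig_el[OF arrows_toD(4)[OF r] x]
        nat_arrow[OF Sig r x] that by simp
    show "pi_res C r (p1 X x) = p1 (Dom C r) (res SumU r x)" "pi_res C r (p2 X x) = p2 (Dom C r) (res SumU r x)"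
      unfolding p1_def p2_def pi_res_def restrict_def
      using arrows_to_Comp(1)[OF cat r] fib d_res[OF r _ x] by (auto simp: fun_eq_iff)
  qed
  let ?e = "\<lambda>X x. fam_mor_of X (Sig X x) x (p1 X x) (p2 X x)"
  have e: "?e X x \<in> ihom (type_fam M) X (fob \<Delta> X (Sig X x)) x" if "X \<in> Obj C" "x \<in> el SumU X" for X x
    by (rule fam_mor_of_ihom[OF that(1) Sig_el[OF that] that(2) sec[OF that]])
  have "?e (Dom C r) (res SumU r x) = res (imor (type_fam M)) r (?e (Cod C r) x)"
    if "r \<in> Arr C" and x: "x \<in> el SumU (Cod C r)" for r x
  proof -
    have r: "r \<in> arrows_to C (Cod C r)" using that by (simp add: arrows_to_def)
    show ?thesis
      using fam_mor_of_res[OF r Sig_el[OF arrows_toD(4)[OF r] x] sec[OF arrows_toD(4)[OF r] x]]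
      by (simp only: p_res[OF r x] nat_arrow[OF Sig r x])
  qed
  then have "nat_trans C SumU (imor (type_fam M)) ?e"
    unfolding nat_trans_def using e by (auto simp: ihom_iff)
  moreover have "\<exists>!k. k \<in> ihom (type_icat M) X T (Sig X x) \<and> icomp (type_fam M) X (?e X x, fmor \<Delta> X k) = h"
    if X: "X \<in> Obj C" and x: "x \<in> el SumU X" and T: "T \<in> el (base F) X" and h: "h \<in> ihom (type_fam M) X (fob \<Delta> X T) x"
    for X x T h
  proof -
    obtain f g where fg: "(f, g) \<in> sections X T x" and h_eq: "h = fam_mor_of X T x f g"
      using fam_mor_of_surj[OF X T h] by blast
    note D = sectionsD[OF fg]
    have q: "Q x s (f (s, t)) (g (s, t))" if "s \<in> arrows_to C X" "t \<in> fibre C F T s" for s t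
      unfolding Q_iff[OF that(1) x] using exp_el_app[OF D(1) that] D(2,3)[OF that] by blast
    \<comment> \<open>The transpose of \<open>h\<close> sends \<open>t\<close> to the pair of
      \<open>f t\<close> and \<open>g t\<close>.\<close>
    define k where "k = (\<lambda>(s, t) \<in> (SIGMA s:arrows_to C X. fibre C F T s). c x s (f (s, t)) (g (s, t)))"
    have k_app: "k (s, t) = c x s (f (s, t)) (g (s, t))" if "s \<in> arrows_to C X" "t \<in> fibre C F T s" for s t
      using that by (simp add: k_def)
    have k: "k \<in> exp_el C F X T (Sig X x)"
    proof -
      have "k (s, t) \<in> fibre C F (Sig X x) s" if "s \<in> arrows_to C X" "t \<in> fibre C F T s" for s t
        unfolding k_app[OF that] by (rule c_el[OF that(1) x q[OF that]])
      moreover have "k (s, t) = undefined" if "\<not> (s \<in> arrows_to C X \<and> t \<in> fibre C F T s)" for s t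
        using that unfolding k_def restrict_def by auto
      moreover have "k (Comp C s r, res (total F) r t) = res (total F) r (k (s, t))"
        if s: "s \<in> arrows_to C X" and r: "r \<in> arrows_to C (Dom C s)" and t: "t \<in> fibre C F T s" for s r t
        by (simp only: k_app[OF s t] k_app[OF arrows_to_Comp(1)[OF cat s r] fibre_Comp[OF cat fam s r T t]]
          exp_el_nat[OF D(1) s r t] D(5)[OF s r t] c_nat(2)[OF s r x q[OF s t]])
      ultimately show ?thesis unfolding exp_el_def pi_el_iff by blast
    qed
    \<comment> \<open>Pairing and decomposition are mutually inverse on each fibre, so the equations
      for \<open>k'\<close> say that \<open>k'\<close> agrees with \<open>k\<close> at every
      argument. This yields existence and uniqueness together.\<close>
    have iff: "icomp (type_fam M) X (?e X x, fmor \<Delta> X (T, Sig X x, k')) = h \<longleftrightarrow> k' = k"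
      if k': "k' \<in> exp_el C F X T (Sig X x)" for k'
    proof -
      have "p1 X x (s, k' (s, t)) = f (s, t) \<and> p2 X x (s, k' (s, t)) = g (s, t) \<longleftrightarrow> k' (s, t) = k (s, t)"
        if s: "s \<in> arrows_to C X" and t: "t \<in> fibre C F T s" for s t
      proof -
        note m = exp_el_app[OF k' s t]
        show ?thesis unfolding p[OF s m] k_app[OF s t] using d(2)[OF s x m] d_eq[OF s x m q[OF s t]] by metis
      qed
      moreover have "k' = k \<longleftrightarrow> (\<forall>s\<in>arrows_to C X. \<forall>t\<in>fibre C F T s. k' (s, t) = k (s, t))"
        unfolding fun_eq_iff using exp_el_undefined[OF k] exp_el_undefined[OF k'] by (metis surj_pair)
      ultimately show ?thesis
        unfolding h_eq fam_mor_of_comp_eq_iff[OF T sec[OF X x] fg k'] by blast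
    qed
    show ?thesis
    proof (rule ex1I[of _ "(T, Sig X x, k)"])
      show "(T, Sig X x, k) \<in> ihom (type_icat M) X T (Sig X x) \<and>
          icomp (type_fam M) X (?e X x, fmor \<Delta> X (T, Sig X x, k)) = h"
        unfolding ihom_type_icat iff[OF k] using T Sig_el[OF X x] k by blast
    next
      fix k' assume "k' \<in> ihom (type_icat M) X T (Sig X x) \<and> icomp (type_fam M) X (?e X x, fmor \<Delta> X k') = h"
      then show "k' = (T, Sig X x, k)" unfolding ihom_type_icat using iff by blast
    qed
  qed
  ultimately have "universal_arrows C (type_icat M) (type_fam M) \<Delta> Sig ?e"
    unfolding universal_arrows_def type_fam_sel using Sig e by blast
  then show ?thesis
    by (rule adjunction_of_universal_arrows[OF cat internal_categories diag])
qed

section \<open>From universal arrows to dependent sums\<close>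

lemma dependent_sums_if_universal_arrows:
  assumes u: "universal_arrows C (type_icat M) (type_fam M) \<Delta> Sig e"
  shows "admits_dependent_sum_types M"
proof -
  have Sig: "nat_trans C SumU (base F) Sig" and e_nat: "nat_trans C SumU (imor (type_fam M)) e"
    and e: "\<And>X x. X \<in> Obj C \<Longrightarrow> x \<in> el SumU X \<Longrightarrow> e X x \<in> ihom (type_fam M) X (fob \<Delta> X (Sig X x)) x"
    and ex1: "\<And>X x T h. X \<in> Obj C \<Longrightarrow> x \<in> el SumU X \<Longrightarrow> T \<in> el (base F) X \<Longrightarrow>
      h \<in> ihom (type_fam M) X (fob \<Delta> X T) x \<Longrightarrow>
      \<exists>!k. k \<in> ihom (type_icat M) X T (Sig X x) \<and> icomp (type_fam M) X (e X x, fmor \<Delta> X k) = h"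
    using u unfolding universal_arrows_def type_fam_sel by blast+
  have Sig_el: "Sig X x \<in> el (base F) X" if "X \<in> Obj C" "x \<in> el SumU X" for X x
    using nat_trans_el[OF Sig that] .
  \<comment> \<open>The source of the counit at \<open>x\<close> is the image of
    \<open>Sig X x\<close> under \<open>\<Delta>\<close>, so the counit is itself represented by two
    projections. They are chosen separately for each stage and each \<open>x\<close>.\<close>
  have "\<exists>pq. pq \<in> sections X (Sig X x) x \<and> e X x = fam_mor_of X (Sig X x) x (fst pq) (snd pq)"
    if "X \<in> Obj C" "x \<in> el SumU X" for X x
    using fam_mor_of_surj[OF that(1) Sig_el[OF that] e[OF that]] by (metis fst_conv snd_conv)
  then obtain pq where pq: "\<And>X x. X \<in> Obj C \<Longrightarrow> x \<in> el SumU X \<Longrightarrow>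
      pq X x \<in> sections X (Sig X x) x \<and> e X x = fam_mor_of X (Sig X x) x (fst (pq X x)) (snd (pq X x))"
    by metis
  define p where "p = (\<lambda>X x. fst (pq X x))"
  define q where "q = (\<lambda>X x. snd (pq X x))"
  have sec: "(p X x, q X x) \<in> sections X (Sig X x) x"
    and e_eq: "e X x = fam_mor_of X (Sig X x) x (p X x) (q X x)"
    if "X \<in> Obj C" "x \<in> el SumU X" for X x
    using pq[OF that] by (simp_all add: p_def q_def)
  let ?fib = "\<lambda>X x. fibre C F (Sig X x) (Idn C X)"
  have comp_el: "(fst x, snd x, p X x (Idn C X, g), q X x (Idn C X, g)) \<in> el (pair_psh M) X"
    if X: "X \<in> Obj C" and x: "x \<in> el SumU X" and g: "g \<in> ?fib X x" for X x g
  proof -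
    note I = Idn_arrows_to[OF X] and D = sectionsD[OF sec[OF X x]]
    have "p X x (Idn C X, g) \<in> fibre C F (fst x) (Idn C X)"
      using exp_el_app[OF D(1) _ g] I by blast
    then show ?thesis
      unfolding pair_psh_iff fibre_Idn[OF X SumU_fst[OF x]] using x D(2,3)[OF conjunct1[OF I] g] I by simp
  qed
  \<comment> \<open>Compatibility of the choices between stages: naturality of \<open>e\<close>
    equates the morphism represented at \<open>Dom C r\<close> with the one represented by the
    restricted projections, and \<open>fam_mor_of_eqD\<close> compares the two at the
    identity.\<close>
  have res_comp: "res (total F) r g \<in> ?fib (Dom C r) (res SumU r x)"
    "p (Dom C r) (res SumU r x) (Idn C (Dom C r), res (total F) r g) = res (total F) r (p X x (Idn C X, g))"
    "q (Dom C r) (res SumU r x) (Idn C (Dom C r), res (total F) r g) = res (total F) r (q X x (Idn C X, g))"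
    if r: "r \<in> arrows_to C X" and x: "x \<in> el SumU X" and g: "g \<in> ?fib X x" for X r x g
  proof -
    let ?Y = "Dom C r" and ?x = "res SumU r x"
    note X = arrows_toD(4)[OF r] and Y = arrows_toD(3)[OF r] and x' = res_arrow[OF psh(3) r x]
    note I = arrows_toD(7)[OF r]
    note D = sectionsD[OF sec[OF X x]] and D' = sectionsD[OF sec[OF Y x']]
    have g': "g \<in> el (total F) X" "proj F X g = Sig X x"
      using g unfolding fibre_Idn[OF X Sig_el[OF X x]] by blast+
    show rg: "res (total F) r g \<in> ?fib ?Y ?x"
      unfolding fibre_Idn[OF Y Sig_el[OF Y x']]
      using res_arrow[OF psh(1) r g'(1)] nat_arrow[OF proj r g'(1)] nat_arrow[OF Sig r x] g'(2) by simp
    have rg': "res (total F) r g \<in> fibre C F (Sig X x) r"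
      unfolding fibre_iff using res_arrow[OF psh(1) r g'(1)] nat_arrow[OF proj r g'(1)] g'(2) by simp
    have eq: "fam_mor_of ?Y (Sig ?Y ?x) ?x (p ?Y ?x) (q ?Y ?x) =
        fam_mor_of ?Y (Sig ?Y ?x) ?x (pi_res C r (p X x)) (pi_res C r (q X x))"
      using nat_arrow[OF e_nat r x] fam_mor_of_res[OF r Sig_el[OF X x] sec[OF X x]]
      unfolding e_eq[OF X x] e_eq[OF Y x'] nat_arrow[OF Sig r x] by simp
    have r_app: "pi_res C r f (Idn C ?Y, v) = f (r, v)" for f :: "'m \<times> 'v \<Rightarrow> 'v" and v
      using arrows_toD[OF r] by (simp add: pi_res_def)
    have "p ?Y ?x (Idn C ?Y, res (total F) r g) = p X x (r, res (total F) r g)"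
      unfolding fam_mor_of_eqD(1)[OF eq] r_app by (rule refl)
    then show "p ?Y ?x (Idn C ?Y, res (total F) r g) = res (total F) r (p X x (Idn C X, g))"
      using exp_el_nat[OF D(1) _ _ g, of r] Idn_arrows_to[OF X] r arrows_toD(6)[OF r] by simp
    have "q ?Y ?x (Idn C ?Y, res (total F) r g) = q X x (r, res (total F) r g)"
      using fam_mor_of_eqD(2)[OF eq I rg] D'(2)[OF I rg] D(2)[OF r rg'] Idn_arrows_to[OF Y]
      unfolding r_app by simp
    then show "q ?Y ?x (Idn C ?Y, res (total F) r g) = res (total F) r (q X x (Idn C X, g))"
      using D(5)[OF _ _ g, of r] Idn_arrows_to[OF X] r arrows_toD(6)[OF r] by simp
  qed
  \<comment> \<open>Universality is tested on the unit type: \<open>a\<close> and \<open>b\<close>,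
    regarded as points, form a map into the dependent sum. Its factorisation through the counit
    gives \<open>g\<close>, and uniqueness of the factorisation gives uniqueness of
    \<open>g\<close>.\<close>
  have pair_ex1: "\<exists>!g. g \<in> ?fib X x \<and> p X x (Idn C X, g) = a \<and> q X x (Idn C X, g) = b"
    if X: "X \<in> Obj C" and abx: "(fst x, snd x, a, b) \<in> el (pair_psh M) X" for X x a b
  proof -
    have x: "x \<in> el SumU X" and a: "a \<in> el (total F) X" "proj F X a = fst x"
      and b: "b \<in> el (total F) X" "proj F X b = snd x (Idn C X, a)"
      using abx unfolding pair_psh_iff by blast+
    note I = Idn_arrows_to[OF X] and D = sectionsD[OF sec[OF X x]]
    let ?T = "one X ()" and ?S = "Sig X x"
    have aI: "a \<in> fibre C F (fst x) (Idn C X)"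
      unfolding fibre_Idn[OF X SumU_fst[OF x]] using a by blast
    have star_fib: "star X () \<in> fibre C F ?T (Idn C X)"
      using fibre_one[OF conjunct1[OF I]] I by simp
    have ab: "(point X a, point X b) \<in> sections X ?T x"
    proof -
      \<comment> \<open>The family \<open>snd x\<close> is natural, so its value at the restriction
        of \<open>a\<close> along \<open>s\<close> is the restriction of the type of
        \<open>b\<close>.\<close>
      have "proj F (Dom C s) (res (total F) s b) = snd x (s, res (total F) s a)"
        if s: "s \<in> arrows_to C X" for s
        using sum_exp_nat[of "fst x" "snd x" C F "base F" X "Idn C X" s a] x I aI s
          nat_arrow[OF proj s b(1)] arrows_toD(6)[OF s] b(2) by simp
      moreover have "point X b (s, u) = undefined"
        if "\<not> (s \<in> arrows_to C X \<and> u \<in> fibre C F ?T s)" for s u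
        using that by (auto simp: point_def)
      ultimately show ?thesis
        using point_el[OF a(1)] point_nat[OF b(1)] res_arrow[OF psh(1) _ b(1)]
        unfolding sections_def mem_Collect_eq prod.case a(2) pi_el_iff
        by (simp add: point_app)
    qed
    let ?h = "fam_mor_of X ?T x (point X a) (point X b)"
    have h: "?h \<in> ihom (type_fam M) X (fob \<Delta> X ?T) x"
      by (rule fam_mor_of_ihom[OF X one[OF X] x ab])
    \<comment> \<open>Evaluating the factorisation equations at the identity and \<open>star\<close>
      gives the two equations for \<open>g\<close>; conversely, naturality of \<open>p X x\<close>
      and \<open>q X x\<close> carries those to every \<open>s\<close>.\<close>
    have mediate_iff: "(?T, ?S, point X g) \<in> ihom (type_icat M) X ?T ?S \<and>
        icomp (type_fam M) X (e X x, fmor \<Delta> X (?T, ?S, point X g)) = ?h \<longleftrightarrow>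
        p X x (Idn C X, g) = a \<and> q X x (Idn C X, g) = b"
      if g: "g \<in> ?fib X x" for g
    proof -
      have g': "g \<in> el (total F) X" "proj F X g = ?S"
        using g unfolding fibre_Idn[OF X Sig_el[OF X x]] by blast+
      have pg: "point X g \<in> exp_el C F X ?T ?S" using point_el[OF g'(1)] g'(2) by simp
      have r: "p X x (s, res (total F) s g) = res (total F) s (p X x (Idn C X, g))"
        "q X x (s, res (total F) s g) = res (total F) s (q X x (Idn C X, g))"
        if s: "s \<in> arrows_to C X" for s
        using exp_el_nat[OF D(1) _ _ g, of s] D(5)[OF _ _ g, of s] I s arrows_toD(6)[OF s] by simp_all
      have "(\<forall>s\<in>arrows_to C X. \<forall>u\<in>fibre C F ?T s.
          p X x (s, point X g (s, u)) = point X a (s, u) \<and> q X x (s, point X g (s, u)) = point X b (s, u)) \<longleftrightarrow>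
          p X x (Idn C X, g) = a \<and> q X x (Idn C X, g) = b" (is "?L \<longleftrightarrow> ?R")
      proof
        assume ?L
        then show ?R
          using I star_fib point_star[OF X g'(1)] point_star[OF X a(1)] point_star[OF X b(1)] by metis
      next
        assume ?R
        then show ?L by (simp add: point_app r)
      qed
      then show ?thesis
        unfolding e_eq[OF X x] fam_mor_of_comp_eq_iff[OF one[OF X] sec[OF X x] ab pg] ihom_type_icat
        using one[OF X] Sig_el[OF X x] pg by blast
    qed
    obtain k where k: "k \<in> ihom (type_icat M) X ?T ?S \<and> icomp (type_fam M) X (e X x, fmor \<Delta> X k) = ?h"
      and k_uniq: "\<And>k'. k' \<in> ihom (type_icat M) X ?T ?S \<and> icomp (type_fam M) X (e X x, fmor \<Delta> X k') = ?h \<Longrightarrow> k' = k"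
      using ex1[OF X x one[OF X] h] by (elim ex1E) blast
    obtain \<phi> where k_eq: "k = (?T, ?S, \<phi>)" and \<phi>: "\<phi> \<in> exp_el C F X ?T ?S"
      using k unfolding ihom_type_icat by blast
    \<comment> \<open>By \<open>exp_el_one\<close> the mediating map is the point of this
      term.\<close>
    let ?g = "\<phi> (Idn C X, star X ())"
    have g: "?g \<in> ?fib X x" using exp_el_app[OF \<phi> conjunct1[OF I] star_fib] .
    show ?thesis
    proof (rule ex1I[of _ ?g])
      show "?g \<in> ?fib X x \<and> p X x (Idn C X, ?g) = a \<and> q X x (Idn C X, ?g) = b"
        using g mediate_iff[OF g] k unfolding k_eq exp_el_one[OF X \<phi>, symmetric] by blast
    next
      fix g' assume g': "g' \<in> ?fib X x \<and> p X x (Idn C X, g') = a \<and> q X x (Idn C X, g') = b"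
      then have "(?T, ?S, point X g') = k" using mediate_iff k_uniq by blast
      then have "point X g' = \<phi>" unfolding k_eq by simp
      moreover have "g' \<in> el (total F) X" using g' unfolding fibre_Idn[OF X Sig_el[OF X x]] by blast
      ultimately show "g' = ?g" using point_star[OF X] by metis
    qed
  qed
  \<comment> \<open>The inverse of the two projections at the identity arrow, well defined by
    \<open>pair_ex1\<close>.\<close>
  define pair where "pair = (\<lambda>X (A, B, a, b). THE g. g \<in> ?fib X (A, B) \<and>
    p X (A, B) (Idn C X, g) = a \<and> q X (A, B) (Idn C X, g) = b)"
  have pair: "pair X (fst x, snd x, a, b) \<in> ?fib X x"
    "p X x (Idn C X, pair X (fst x, snd x, a, b)) = a" "q X x (Idn C X, pair X (fst x, snd x, a, b)) = b"
    and pair_eq: "\<And>g. g \<in> ?fib X x \<Longrightarrow> p X x (Idn C X, g) = a \<Longrightarrow> q X x (Idn C X, g) = b \<Longrightarrow>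
      pair X (fst x, snd x, a, b) = g"
    if X: "X \<in> Obj C" and ab: "(fst x, snd x, a, b) \<in> el (pair_psh M) X" for X x a b
  proof -
    have eq: "pair X (fst x, snd x, a, b) = (THE g. g \<in> ?fib X x \<and> p X x (Idn C X, g) = a \<and> q X x (Idn C X, g) = b)"
      by (simp add: pair_def)
    show "pair X (fst x, snd x, a, b) \<in> ?fib X x"
      "p X x (Idn C X, pair X (fst x, snd x, a, b)) = a" "q X x (Idn C X, pair X (fst x, snd x, a, b)) = b"
      using theI'[OF pair_ex1[OF X ab]] unfolding eq by blast+
    show "pair X (fst x, snd x, a, b) = g"
      if "g \<in> ?fib X x" "p X x (Idn C X, g) = a" "q X x (Idn C X, g) = b" for g
      unfolding eq using that by (intro the1_equality[OF pair_ex1[OF X ab]]) blast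
  qed
  have cell: "\<exists>x a b. z = (fst x, snd x, a, b)" for z :: "'u \<times> ('m \<times> 'v \<Rightarrow> 'u) \<times> 'v \<times> 'v"
    by (cases z) (metis fst_conv snd_conv)
  have cell_Sum: "x \<in> el SumU X" if "(fst x, snd x, a, b) \<in> el (pair_psh M) X" for X x a b
    using that unfolding pair_psh_iff by blast
  have "nat_trans C (pair_psh M) (total F) pair"
    unfolding nat_trans_def
  proof (intro conjI ballI)
    fix X z assume X: "X \<in> Obj C" and z: "z \<in> el (pair_psh M) X"
    obtain x a b where z_eq: "z = (fst x, snd x, a, b)" using cell by blast
    show "pair X z \<in> el (total F) X"
      using pair(1)[OF X z[unfolded z_eq]] fibre_Idn[OF X Sig_el[OF X cell_Sum[OF z[unfolded z_eq]]]]
      unfolding z_eq by blast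
  next
    fix r z assume r': "r \<in> Arr C" and z: "z \<in> el (pair_psh M) (Cod C r)"
    have r: "r \<in> arrows_to C (Cod C r)" using r' by (simp add: arrows_to_def)
    obtain x a b where z_eq: "z = (fst x, snd x, a, b)" using cell by blast
    note z' = z[unfolded z_eq]
    note x = cell_Sum[OF z'] and X = arrows_toD(4)[OF r] and Y = arrows_toD(3)[OF r]
    have e: "res (pair_psh M) r (fst x, snd x, a, b) = (fst (res SumU r x), snd (res SumU r x), res (total F) r a, res (total F) r b)"
      by (simp add: pair_psh_res SumU_res)
    have "res (pair_psh M) r (fst x, snd x, a, b) \<in> el (pair_psh M) (Dom C r)"
      by (rule res_arrow[OF psh(4) r z'])
    \<comment> \<open>By \<open>res_comp\<close>, the restriction of the paired term projects to the
      restrictions of \<open>a\<close> and \<open>b\<close>; \<open>pair_eq\<close> then identifies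
      it with their pairing.\<close>
    then show "pair (Dom C r) (res (pair_psh M) r z) = res (total F) r (pair (Cod C r) z)"
      using pair_eq[OF Y _ res_comp(1)[OF r x pair(1)[OF X z']]] res_comp(2,3)[OF r x pair(1)[OF X z']]
        pair(2,3)[OF X z'] unfolding z_eq e by simp
  qed
  moreover have "proj F W (pair W z) = Sig W (pair_proj W z)" if W: "W \<in> Obj C" and z: "z \<in> el (pair_psh M) W" for W z
  proof -
    obtain x a b where z_eq: "z = (fst x, snd x, a, b)" using cell by blast
    show ?thesis
      using pair(1)[OF W z[unfolded z_eq]] fibre_Idn[OF W Sig_el[OF W cell_Sum[OF z[unfolded z_eq]]]]
      by (simp add: z_eq pair_proj_def)
  qed
  moreover have "\<exists>!z. z \<in> el (pair_psh M) W \<and> pair W z = g \<and> pair_proj W z = x"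
    if W: "W \<in> Obj C" and x: "x \<in> el SumU W" and g: "g \<in> el (total F) W" "proj F W g = Sig W x" for W x g
  proof (rule ex1I[of _ "(fst x, snd x, p W x (Idn C W, g), q W x (Idn C W, g))"])
    have gf: "g \<in> ?fib W x" unfolding fibre_Idn[OF W Sig_el[OF W x]] using g by blast
    show "(fst x, snd x, p W x (Idn C W, g), q W x (Idn C W, g)) \<in> el (pair_psh M) W \<and>
        pair W (fst x, snd x, p W x (Idn C W, g), q W x (Idn C W, g)) = g \<and>
        pair_proj W (fst x, snd x, p W x (Idn C W, g), q W x (Idn C W, g)) = x"
      using comp_el[OF W x gf] pair_eq[OF W comp_el[OF W x gf] gf] by (simp add: pair_proj_def)
  next
    fix z assume z: "z \<in> el (pair_psh M) W \<and> pair W z = g \<and> pair_proj W z = x"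
    then obtain a b where z_eq: "z = (fst x, snd x, a, b)" by (cases z) (auto simp: pair_proj_def)
    have z': "(fst x, snd x, a, b) \<in> el (pair_psh M) W" using z unfolding z_eq by blast
    show "z = (fst x, snd x, p W x (Idn C W, g), q W x (Idn C W, g))"
      using pair(2,3)[OF W z'] z unfolding z_eq by simp
  qed
  ultimately have "is_pullback C (pair_psh M) (total F) SumU (base F) pair pair_proj Sig (proj F)"
    unfolding is_pullback_iff_pointwise[OF cat psh(4) psh(1) psh(3)] using pair_proj Sig proj by blast
  then show ?thesis unfolding admits_dependent_sum_types_def by blast
qed

end

theorem theorem3p1p13:
  fixes M :: "('o, 'm, 'v, 'u) nmodel"
    and one :: "'o \<Rightarrow> unit \<Rightarrow> 'u"
    and star :: "'o \<Rightarrow> unit \<Rightarrow> 'v"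
  assumes "natural_model M"
    and "unit_type M one star"
  shows "admits_dependent_sum_types M \<longleftrightarrow>
    has_internal_right_adjoint (ctx M) (type_icat M) (type_fam M) (diag_functor M one)"
proof -
  interpret unital_natural_model M one star
    using assms by unfold_locales
  show ?thesis
    using right_adjoint_if_dependent_sums dependent_sums_if_universal_arrows
      universal_arrows_of_adjunction[OF internal_categories]
    unfolding admits_dependent_sum_types_def has_internal_right_adjoint_def by blast
qed

end
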